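(* For any finite-dimensional $\mathbb H\rtimes\langle\theta\rangle$-modules $X$ and $Y$, $$\mathrm{EP}^\theta_{\mathbb H}(X,Y)=\frac1{|W|}\sum_{w\in W}\mathrm{tr}_X(w\theta)\,\overline{\mathrm{tr}_Y(w\theta)}\,\det\nolimits_V(1-w\theta).$$ The right side is the $\theta$-twisted elliptic pairing $\langle\mathrm{Res}_{W\rtimes\langle\theta\rangle}X,\mathrm{Res}_{W\rtimes\langle\theta\rangle}Y\rangle^{\theta\text{-ellip},V}_W$. In particular, $\mathrm{EP}^\theta_{\mathbb H}(X,Y)$ depends only on the $W\rtimes\langle\theta\rangle$-module structures of $X$ and $Y$.
   Context: Let $R$ be a reduced crystallographic root system with simple roots $\Delta$ and positive roots $R^+$, contained in a real vector space $V_0$. Let $W$ be its Weyl group, $w_0$ its longest element, and $\alpha^\vee\in V_0^\vee$ the coroots, with $s_\alpha(v)=v-\langle v,\alpha^\vee\rangle\alpha$. Put $V=\mathbb C\otimes V_0$. Let $k:R\to\mathbb R$ be constant on $W$-orbits. **The algebra.** $\mathbb H$ is the graded affine Hecke algebra: generated by the subalgebras $\mathbb C[W]$ (basis $t_w$) and $S(V)$, with $t_{s_\alpha}v-s_\alpha(v)t_{s_\alpha}=k_\alpha\langle v,\alpha^\vee\rangle$ for $\alpha\in\Delta$. **The involution.** $\theta$ is the involution of $\mathbb H$ with $\theta(v)=-w_0(v)$ and $\theta(t_w)=t_{w_0ww_0^{-1}}$. $\theta$ also denotes $v\mapsto -w_0(v)$ on $V$ and $w\mapsto w_0ww_0^{-1}$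 on $W$. $\mathbb H\rtimes\langle\theta\rangle$ and $W\rtimes\langle\theta\rangle$ are the semidirect products, and $\mathrm{tr}_X(w\theta)$ is the trace of $t_w\theta$ on $X$. **The twisted Euler–Poincaré pairing.** For $\mathbb H\rtimes\langle\theta\rangle$-modules $X,Y$, consider the complex $C^i=\mathrm{Hom}_{\mathbb C[W]}(X\otimes\wedge^iV,Y)$ ($W$ acting diagonally), with differential $$(d^*\psi)(x\otimes v_1\wedge\cdots\wedge v_{i+1})=\sum_{j}(-1)^j\big(v_j.\psi(x\otimes v_1\wedge\cdots\widehat{v_j}\cdots\wedge v_{i+1})-\psi(v_j.x\otimes v_1\wedge\cdots\widehat{v_j}\cdots\wedge v_{i+1})\big).$$ Its cohomology is $\mathrm{Ext}^i_{\mathbb H}(X,Y)$: it is obtained by applying $\mathrm{Hom}_{\mathbb H}(-,Y)$ to the resolution $\mathbb H\otimes_{\mathbb C[W]}(X\otimes\wedge^iV)$ of $X$ together with Frobenius reciprocity. The map $\theta^*(\psi)(x\otimes v_1\wedge\cdots\wedge v_i)=\theta.\psi(\theta.x\otimes\theta(v_1)\wedge\cdots\wedge\theta(v_i))$ commutes with $d^*$, and so induces $\theta^*$ on $\mathrm{Ext}^i_{\mathbb H}(X,Y)$. Then $$\mathrm{EP}^\theta_{\mathbb H}(X,Y)=\sum_i(-1)^i\,\mathrm{trace}(\theta^*\mid\mathrm{Ext}^i_{\mathbb H}(X,Y)).$$ *)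

theory Defs
  imports "HOL-Analysis.Analysis" "HOL-Library.Function_Algebras"
begin

text \<open>V_0 = real^'n. Coroots are given by a function cor : R -> real^'n, and the
pairing of v in V_0 with the coroot of alpha is v \<bullet> cor alpha (V_0^dual identified with
real^'n via the standard dot product; this is only a choice of coordinates).\<close>

definition refl_mat :: "real^'n \<Rightarrow> real^'n \<Rightarrow> real^'n^'n" where
  "refl_mat a c = (\<chi> i j. (if i = j then 1 else 0) - a $ i * c $ j)"
  \<comment> \<open>matrix of v \<mapsto> v - (v \<bullet> c) a\<close>

definition sref :: "(real^'n \<Rightarrow> real^'n) \<Rightarrow> real^'n \<Rightarrow> real^'n^'n" where
  "sref cor a = refl_mat a (cor a)"

definition reduced_cryst_root_system :: "(real^'n) set \<Rightarrow> (real^'n \<Rightarrow> real^'n) \<Rightarrow> bool" where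
  "reduced_cryst_root_system R cor \<longleftrightarrow>
     finite R \<and> 0 \<notin> R \<and>
     (\<forall>a\<in>R. a \<bullet> cor a = 2) \<and>
     (\<forall>a\<in>R. \<forall>b\<in>R. sref cor a *v b \<in> R) \<and>
     (\<forall>a\<in>R. \<forall>b\<in>R. cor (sref cor a *v b) = cor b - (a \<bullet> cor b) *\<^sub>R cor a) \<and>
     (\<forall>a\<in>R. \<forall>b\<in>R. b \<bullet> cor a \<in> \<int>) \<and>
     (\<forall>a\<in>R. \<forall>c::real. c *\<^sub>R a \<in> R \<longrightarrow> c = 1 \<or> c = -1)"

definition nonneg_int_comb :: "(real^'n) set \<Rightarrow> real^'n \<Rightarrow> bool" where
  "nonneg_int_comb D b \<longleftrightarrow> (\<exists>m::real^'n \<Rightarrow> nat. b = (\<Sum>d\<in>D. real (m d) *\<^sub>R d))"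

definition simple_system :: "(real^'n) set \<Rightarrow> (real^'n) set \<Rightarrow> bool" where
  "simple_system R D \<longleftrightarrow> D \<subseteq> R \<and> independent D \<and>
     (\<forall>b\<in>R. nonneg_int_comb D b \<or> nonneg_int_comb D (- b))"

definition pos_roots :: "(real^'n) set \<Rightarrow> (real^'n) set \<Rightarrow> (real^'n) set" where
  "pos_roots R D = {b \<in> R. nonneg_int_comb D b}"

inductive_set weyl :: "(real^'n) set \<Rightarrow> (real^'n \<Rightarrow> real^'n) \<Rightarrow> (real^'n^'n) set"
  for R cor where
  weyl_one: "mat 1 \<in> weyl R cor"
| weyl_step: "a \<in> R \<Longrightarrow> w \<in> weyl R cor \<Longrightarrow> sref cor a ** w \<in> weyl R cor"

definition wlen :: "(real^'n \<Rightarrow> real^'n) \<Rightarrow> (real^'n) set \<Rightarrow> real^'n^'n \<Rightarrow> nat" where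
  "wlen cor D w = (LEAST l. \<exists>as. length as = l \<and> set as \<subseteq> D \<and>
        w = foldr (\<lambda>a M. sref cor a ** M) as (mat 1))"

definition longest :: "(real^'n) set \<Rightarrow> (real^'n \<Rightarrow> real^'n) \<Rightarrow> (real^'n) set \<Rightarrow> real^'n^'n" where
  "longest R cor D = (THE w0. w0 \<in> weyl R cor \<and>
        (\<forall>u\<in>weyl R cor. wlen cor D u \<le> wlen cor D w0))"

definition cmat :: "real^'n^'m \<Rightarrow> complex^'n^'m" where
  "cmat M = (\<chi> i j. complex_of_real (M $ i $ j))"

definition cmv :: "real^'n^'m \<Rightarrow> complex^'n \<Rightarrow> complex^'m" where
  "cmv M v = cmat M *v v"

definition cpair :: "complex^'n \<Rightarrow> real^'n \<Rightarrow> complex" where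
  "cpair v c = (\<Sum>i\<in>UNIV. v $ i * complex_of_real (c $ i))"

definition thetaV :: "real^'n^'n \<Rightarrow> complex^'n \<Rightarrow> complex^'n" where
  "thetaV w0 v = - cmv w0 v"

definition cscale :: "complex \<Rightarrow> complex^'a^'b \<Rightarrow> complex^'a^'b" where
  "cscale c M = (\<chi> i j. c * M $ i $ j)"

text \<open>A finite-dimensional H \<rtimes> <theta>-module on X = complex^'x is given by
  tX : W -> End(X) (action of t_w), vX : V -> End(X) (action of V \<subseteq> S(V)),
  and ThX (action of theta), subject to the defining relations of H and of the
  semidirect product.\<close>

definition H_theta_module ::
  "(real^'n) set \<Rightarrow> (real^'n \<Rightarrow> real^'n) \<Rightarrow> (real^'n) set \<Rightarrow> (real^'n \<Rightarrow> real)
   \<Rightarrow> (real^'n^'n \<Rightarrow> complex^'x^'x) \<Rightarrow> (complex^'n \<Rightarrow> complex^'x^'x) \<Rightarrow> complex^'x^'x \<Rightarrow> bool" where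
  "H_theta_module R cor D k tX vX ThX \<longleftrightarrow>
     (let W = weyl R cor; w0 = longest R cor D in
      tX (mat 1) = mat 1 \<and>
      (\<forall>w\<in>W. \<forall>u\<in>W. tX (w ** u) = tX w ** tX u) \<and>
      (\<forall>a b. vX (a + b) = vX a + vX b) \<and>
      (\<forall>c a. vX (c *s a) = cscale c (vX a)) \<and>
      (\<forall>a b. vX a ** vX b = vX b ** vX a) \<and>
      (\<forall>a\<in>D. \<forall>v. tX (sref cor a) ** vX v - vX (cmv (sref cor a) v) ** tX (sref cor a)
                 = cscale (complex_of_real (k a) * cpair v (cor a)) (mat 1)) \<and>
      ThX ** ThX = mat 1 \<and>
      (\<forall>w\<in>W. ThX ** tX w ** ThX = tX (w0 ** w ** matrix_inv w0)) \<and>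
      (\<forall>v. ThX ** vX v ** ThX = vX (thetaV w0 v)))"

text \<open>An element of Hom(X \<otimes> \<wedge>^i V, Y) is represented as an alternating i-multilinear map
  psi : V^i -> Hom(X,Y) = complex^'x^'y (arguments are the first i entries of a
  sequence nat => V).\<close>

type_synonym ('n,'x,'y) cochain = "(nat \<Rightarrow> complex^'n::finite) \<Rightarrow> complex^'x::finite^'y::finite"

definition cscale_fun :: "complex \<Rightarrow> ('n::finite,'x::finite,'y::finite) cochain \<Rightarrow> ('n::finite,'x::finite,'y::finite) cochain" where
  "cscale_fun c f = (\<lambda>vs. cscale c (f vs))"

definition cochains ::
  "(real^'n) set \<Rightarrow> (real^'n \<Rightarrow> real^'n) \<Rightarrow> (real^'n^'n \<Rightarrow> complex^'x^'x)
   \<Rightarrow> (real^'n^'n \<Rightarrow> complex^'y^'y) \<Rightarrow> nat \<Rightarrow> ('n::finite,'x::finite,'y::finite) cochain set" where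
  "cochains R cor tX tY i = {psi.
     (\<forall>vs vs'. (\<forall>j<i. vs j = vs' j) \<longrightarrow> psi vs = psi vs') \<and>
     (\<forall>vs j a b. j < i \<longrightarrow> psi (vs(j := a + b)) = psi (vs(j := a)) + psi (vs(j := b))) \<and>
     (\<forall>vs j c a. j < i \<longrightarrow> psi (vs(j := c *s a)) = cscale c (psi (vs(j := a)))) \<and>
     (\<forall>vs j l. j < l \<and> l < i \<and> vs j = vs l \<longrightarrow> psi vs = 0) \<and>
     (\<forall>w\<in>weyl R cor. \<forall>vs. psi (\<lambda>j. cmv w (vs j)) ** tX w = tY w ** psi vs)}"

definition omit :: "nat \<Rightarrow> (nat \<Rightarrow> 'a) \<Rightarrow> nat \<Rightarrow> 'a" where
  "omit j vs = (\<lambda>l. if l < j then vs l else vs (Suc l))"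

text \<open>differential d^* : C^i -> C^(i+1); the paper's index j = 1..i+1 is j'+1 here.\<close>
definition dstar ::
  "(complex^'n \<Rightarrow> complex^'x^'x) \<Rightarrow> (complex^'n \<Rightarrow> complex^'y^'y) \<Rightarrow> nat
   \<Rightarrow> ('n::finite,'x::finite,'y::finite) cochain \<Rightarrow> ('n::finite,'x::finite,'y::finite) cochain" where
  "dstar vX vY i psi = (\<lambda>vs. \<Sum>j<Suc i. cscale ((-1) ^ (j + 1))
       (vY (vs j) ** psi (omit j vs) - psi (omit j vs) ** vX (vs j)))"

definition theta_star ::
  "real^'n^'n \<Rightarrow> complex^'x^'x \<Rightarrow> complex^'y^'y \<Rightarrow> ('n::finite,'x::finite,'y::finite) cochain \<Rightarrow> ('n::finite,'x::finite,'y::finite) cochain" where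
  "theta_star w0 ThX ThY psi = (\<lambda>vs. ThY ** psi (\<lambda>j. thetaV w0 (vs j)) ** ThX)"

text \<open>For subspaces B \<subseteq> U of a vector space (over the field 'a, scalar multiplication
  scale) and an endomorphism T preserving U and B, the trace of the induced map on U/B:
  choose a basis bB of B and extend it by cs to a basis of U; the classes of cs form a
  basis of U/B, and the diagonal entry of the induced map at c + B is the coefficient
  of c in T c w.r.t. the basis bB \<union> cs.\<close>

definition quot_trace :: "('a::field \<Rightarrow> 'b::ab_group_add \<Rightarrow> 'b) \<Rightarrow> ('b \<Rightarrow> 'b) \<Rightarrow> 'b set \<Rightarrow> 'b set \<Rightarrow> 'a" where
  "quot_trace sc T U B =
     (let P = (SOME P. fst P \<subseteq> B \<and> fst P \<inter> snd P = {} \<and> finite (fst P \<union> snd P) \<and>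
                 module.independent sc (fst P \<union> snd P) \<and>
                 module.span sc (fst P) = B \<and> module.span sc (fst P \<union> snd P) = U)
      in \<Sum>c\<in>snd P. module.representation sc (fst P \<union> snd P) (T c) c)"

definition cocycles where
  "cocycles R cor tX tY vX vY i = {psi \<in> cochains R cor tX tY i. dstar vX vY i psi = 0}"

definition coboundaries where
  "coboundaries R cor tX tY vX vY i =
     (if i = 0 then {0} else dstar vX vY (i - 1) ` cochains R cor tX tY (i - 1))"

definition ext_theta_trace where
  "ext_theta_trace R cor D tX tY vX vY ThX ThY i =
     quot_trace cscale_fun (theta_star (longest R cor D) ThX ThY)
       (cocycles R cor tX tY vX vY i) (coboundaries R cor tX tY vX vY i)"

text \<open>Ext^i vanishes for i > dim V (the complex is zero there), so the sum is finite.\<close>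
definition EP_theta where
  "EP_theta R cor D (tX :: real^'n^'n \<Rightarrow> complex^'x^'x) (tY :: real^'n^'n \<Rightarrow> complex^'y^'y)
      vX vY ThX ThY =
     (\<Sum>i\<le>CARD('n). (-1) ^ i * ext_theta_trace R cor D tX tY vX vY ThX ThY i)"

definition wtheta :: "real^'n^'n \<Rightarrow> real^'n^'n \<Rightarrow> real^'n^'n" where
  "wtheta w0 w = w ** (- w0)"

definition twisted_elliptic_pairing where
  "twisted_elliptic_pairing R cor D (tX :: real^'n^'n \<Rightarrow> complex^'x^'x) (tY :: real^'n^'n \<Rightarrow> complex^'y^'y) ThX ThY =
     (let W = weyl R cor; w0 = longest R cor D in
       (1 / of_nat (card W)) *
       (\<Sum>w\<in>W. trace (tX w ** ThX) * cnj (trace (tY w ** ThY)) *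
                 det (mat 1 - cmat (wtheta w0 w))))"

end

theory Submission
  imports Defs "HOL-Combinatorics.Permutations"
begin

text \<open>The operator \<open>\<theta>\<^sup>*\<close> acts on the whole complex \<open>C\<^sup>i\<close>, so by the Hopf trace formula the
  alternating sum of its traces on cohomology equals the alternating sum of its traces on the
  \<open>C\<^sup>i\<close>. The differential drops out, and with it the action of \<open>V\<close>. Each \<open>C\<^sup>i\<close> consists of the
  \<open>W\<close>-invariants in \<open>Hom(X \<otimes> \<and>\<^sup>i V, Y)\<close>; averaging over \<open>W\<close> gives the trace there as the mean over
  \<open>w\<close> of \<open>tr\<^sub>X(w\<theta>) tr\<^sub>Y((w\<theta>)\<inverse>) tr(w\<theta> | \<and>\<^sup>i V)\<close>. The alternating sum over \<open>i\<close> of the last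
  factor is \<open>det(1 - w\<theta>)\<close>, and \<open>tr\<^sub>Y((w\<theta>)\<inverse>)\<close> is the complex conjugate of \<open>tr\<^sub>Y(w\<theta>)\<close> since
  \<open>w\<theta>\<close> acts through a finite group. Root system theory enters only to see that the longest element
  is well defined and that simple reflections generate \<open>W\<close>, which reduces the \<open>W\<close>-equivariance of
  the differential to the defining relation of the Hecke algebra.\<close>

section \<open>Weyl groups and the longest element\<close>

text \<open>The delicate point is the equivariance of the differential. Moving t_s past v leaves a
  correction proportional to k, once on the Y side and once on the X side. With L the pairing with
  the coroot of s, these corrections add up to k times the difference of L wedge psi and L wedge
  (psi o s), which vanishes because s negates both L and L wedge psi. For this reason the
  differential is one instance of a general construction \<open>koszul D\<close>, and wedging with a
  linear form is another.

  The trace on C^i is computed without a basis of C^i: the invariants offer no natural one.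
  Averaging all monomial multilinear forms over W and over the symmetric group of the slots gives a
  spanning family, dependent in general, for which the coefficients of a cochain are simply its
  values on coordinate vectors. The averaging brings in the factor 1/(|W| i!). The i! disappears
  again because the monomials are indexed by tuples, and each i-element set of coordinates is the
  image of i! injective tuples.\<close>

lemma sref_apply: "sref cor a *v v = v - (v \<bullet> cor a) *\<^sub>R a"
proof -
  have "(\<Sum>j\<in>UNIV. ((if i = j then 1 else 0) - a $ i * cor a $ j) * v $ j)
      = v $ i - (\<Sum>j\<in>UNIV. v $ j * cor a $ j) * a $ i" for i
  proof -
    have "(\<Sum>j\<in>UNIV. ((if i = j then 1 else 0) - a $ i * cor a $ j) * v $ j)
        = (\<Sum>j\<in>UNIV. (if i = j then v $ j else 0) - (v $ j * cor a $ j) * a $ i)"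
      by (rule sum.cong) (auto simp: left_diff_distrib)
    then show ?thesis by (simp add: sum_subtractf sum_distrib_right)
  qed
  then show ?thesis
    by (simp add: sref_def refl_mat_def vec_eq_iff matrix_vector_mult_def inner_vec_def)
qed

text \<open>This is the fold inside \<open>wlen\<close>; naming it turns lengths of elements into
  lengths of lists over \<open>D\<close>.\<close>

definition word_prod :: "(real^'n \<Rightarrow> real^'n) \<Rightarrow> (real^'n) list \<Rightarrow> real^'n^'n" where
  "word_prod cor as = foldr (\<lambda>a M. sref cor a ** M) as (mat 1)"

lemma word_prod_simps [simp]:
  "word_prod cor [] = mat 1"
  "word_prod cor (a # as) = sref cor a ** word_prod cor as"
  by (simp_all add: word_prod_def)

lemma word_prod_append: "word_prod cor (as @ bs) = word_prod cor as ** word_prod cor bs"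
  by (induction as) (simp_all add: matrix_mul_assoc)

locale based_root_system =
  fixes R D :: "(real^'n) set" and cor :: "real^'n \<Rightarrow> real^'n"
  assumes root_system: "reduced_cryst_root_system R cor"
    and simple_roots: "simple_system R D"
begin

abbreviation W where "W \<equiv> weyl R cor"
abbreviation pos where "pos \<equiv> nonneg_int_comb D"
abbreviation wp where "wp \<equiv> word_prod cor"

lemma finite_R: "finite R" and zero_not_root: "0 \<notin> R"
  and coroot_self: "a \<in> R \<Longrightarrow> a \<bullet> cor a = 2"
  and sref_root: "a \<in> R \<Longrightarrow> b \<in> R \<Longrightarrow> sref cor a *v b \<in> R"
  and cor_sref: "a \<in> R \<Longrightarrow> b \<in> R \<Longrightarrow> cor (sref cor a *v b) = cor b - (a \<bullet> cor b) *\<^sub>R cor a"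
  and root_multiple: "a \<in> R \<Longrightarrow> c *\<^sub>R a \<in> R \<Longrightarrow> c = 1 \<or> c = -1"
  using root_system by (auto simp: reduced_cryst_root_system_def)

lemma simple_root: "d \<in> D \<Longrightarrow> d \<in> R"
  and independent_D: "independent D"
  and pos_or_neg: "b \<in> R \<Longrightarrow> pos b \<or> pos (- b)"
  using simple_roots by (auto simp: simple_system_def)

lemma finite_D: "finite D"
  using finite_R simple_root by (meson finite_subset subsetI)

lemma sref_self: "a \<in> R \<Longrightarrow> sref cor a *v a = - a"
  by (simp add: sref_apply coroot_self scaleR_2)

lemma root_uminus: "a \<in> R \<Longrightarrow> - a \<in> R"
  using sref_root[of a a] by (simp add: sref_self)

lemma sref_sref: "a \<in> R \<Longrightarrow> sref cor a ** sref cor a = mat 1"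
  unfolding matrix_eq
  by (simp add: matrix_vector_mul_assoc[symmetric] sref_apply inner_diff_left coroot_self
      algebra_simps scaleR_2)

lemma cor_uminus: "a \<in> R \<Longrightarrow> cor (- a) = - cor a"
  using cor_sref[of a a] by (simp add: sref_self coroot_self scaleR_2)

lemma sref_uminus: "a \<in> R \<Longrightarrow> sref cor (- a) = sref cor a"
  unfolding matrix_eq by (simp add: sref_apply cor_uminus)

lemma sref_weyl: "a \<in> R \<Longrightarrow> sref cor a \<in> W"
  using weyl_step[OF _ weyl_one, of a R cor] by simp

lemma weyl_mult: "w \<in> W \<Longrightarrow> u \<in> W \<Longrightarrow> w ** u \<in> W"
  by (induction rule: weyl.induct) (auto simp: matrix_mul_assoc[symmetric] intro: weyl_step)

lemma weyl_inverse: "w \<in> W \<Longrightarrow> \<exists>u\<in>W. u ** w = mat 1 \<and> w ** u = mat 1"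
proof (induction rule: weyl.induct)
  case weyl_one
  then show ?case by (intro bexI[of _ "mat 1"]) (auto intro: weyl.weyl_one)
next
  case (weyl_step a w)
  then obtain u where u: "u \<in> W" "u ** w = mat 1" "w ** u = mat 1" by blast
  have "(u ** sref cor a) ** (sref cor a ** w) = u ** (sref cor a ** sref cor a) ** w"
    by (simp only: matrix_mul_assoc)
  then have 1: "(u ** sref cor a) ** (sref cor a ** w) = mat 1"
    by (simp add: sref_sref[OF weyl_step.hyps(1)] u(2))
  have "(sref cor a ** w) ** (u ** sref cor a) = sref cor a ** (w ** u) ** sref cor a"
    by (simp only: matrix_mul_assoc)
  then have 2: "(sref cor a ** w) ** (u ** sref cor a) = mat 1"
    by (simp add: sref_sref[OF weyl_step.hyps(1)] u(3))
  show ?case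
    using weyl_mult[OF u(1) sref_weyl[OF weyl_step.hyps(1)]] 1 2 by blast
qed

text \<open>\<open>matrix_inv\<close> is a choice of a two-sided inverse; uniqueness of inverses
  identifies it with the one that \<open>weyl_inverse\<close> finds in \<open>W\<close>.\<close>

lemma weyl_matrix_inv:
  assumes "w \<in> W"
  shows "matrix_inv w \<in> W" "matrix_inv w ** w = mat 1" "w ** matrix_inv w = mat 1"
proof -
  obtain u where u: "u \<in> W" "u ** w = mat 1" "w ** u = mat 1"
    using weyl_inverse[OF assms] by blast
  then have "\<exists>A. w ** A = mat 1 \<and> A ** w = mat 1" by blast
  from someI_ex[OF this] show "matrix_inv w ** w = mat 1" "w ** matrix_inv w = mat 1"
    by (simp_all add: matrix_inv_def)
  then have "matrix_inv w ** (w ** u) = u"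
    by (simp add: matrix_mul_assoc)
  then have "matrix_inv w = u" by (simp add: u(3))
  then show "matrix_inv w \<in> W" using u(1) by simp
qed

lemma weyl_root: "w \<in> W \<Longrightarrow> b \<in> R \<Longrightarrow> w *v b \<in> R"
  by (induction rule: weyl.induct) (auto simp: matrix_vector_mul_assoc[symmetric] intro: sref_root)

text \<open>The axiom for coroots of reflected roots propagates along products of reflections: the
  terms quadratic in the new reflection cancel because \<open>a \<bullet> cor a = 2\<close>. Coroots
  can thus be transported by \<open>W\<close> before any invariant form is available.\<close>

lemma weyl_pairing: "w \<in> W \<Longrightarrow> b \<in> R \<Longrightarrow> (w *v v) \<bullet> cor (w *v b) = v \<bullet> cor b"
proof (induction rule: weyl.induct)
  case (weyl_step a w)
  then show ?case
    by (simp add: matrix_vector_mul_assoc[symmetric] cor_sref[OF _ weyl_root]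
        sref_apply[of cor a "w *v v"] inner_diff_left inner_diff_right coroot_self algebra_simps)
qed simp

section \<open>Action on the root span and finiteness of the Weyl group\<close>

text \<open>The roots may span a proper subspace. \<open>W\<close> acts trivially modulo that
  subspace, so two elements of \<open>W\<close> can be compared inside
  \<open>span R\<close>.\<close>

lemma weyl_diff_span: "w \<in> W \<Longrightarrow> w *v v - v \<in> span R"
proof (induction rule: weyl.induct)
  case (weyl_step a w)
  have "(sref cor a ** w) *v v - v = (w *v v - v) - ((w *v v) \<bullet> cor a) *\<^sub>R a"
    by (simp add: matrix_vector_mul_assoc[symmetric] sref_apply)
  also have "\<dots> \<in> span R"
    using weyl_step by (intro span_diff[OF weyl_step.IH] span_scale span_base)
  finally show ?case .
qed (simp add: span_zero)

lemma sref_conj: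
  assumes "w \<in> W" "b \<in> R"
  shows "sref cor (w *v b) ** w = w ** sref cor b"
  unfolding matrix_eq
  by (simp add: matrix_vector_mul_assoc[symmetric] sref_apply weyl_pairing[OF assms]
      matrix_vector_mult_diff_distrib matrix_vector_mult_scaleR)

text \<open>A vector of the root space killed by all coroots is fixed by \<open>W\<close>, hence equals its average
  over \<open>W\<close>. The average of a root \<open>b\<close> vanishes because \<open>s\<^sub>b b = - b\<close>. As \<open>W\<close> is not yet known
  to be finite, the average is taken over the permutations of \<open>R\<close> that it induces.\<close>

lemma span_roots_radical:
  assumes x: "x \<in> span R" and orth: "\<And>b. b \<in> R \<Longrightarrow> x \<bullet> cor b = 0"
  shows "x = 0"
proof -
  obtain c where c: "x = (\<Sum>b\<in>R. c b *\<^sub>R b)"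
    using x by (auto simp: span_finite[OF finite_R])
  define P where "P = (\<lambda>w. restrict ((*v) w) R) ` W"
  have "P \<subseteq> R \<rightarrow>\<^sub>E R"
    unfolding P_def using weyl_root by auto
  then have finP: "finite P"
    using finite_R by (meson finite_PiE finite_subset)
  have "restrict ((*v) (mat 1)) R \<in> P"
    unfolding P_def using weyl_one by blast
  then have "card P > 0"
    using finP by (auto simp: card_gt_0_iff)
  have fixed: "w *v x = x" if "w \<in> W" for w
    using that by induction
      (auto simp: matrix_vector_mul_assoc[symmetric] sref_apply orth)
  have px: "x = (\<Sum>b\<in>R. c b *\<^sub>R p b)" if "p \<in> P" for p
  proof -
    from that obtain w where w: "w \<in> W" "p = restrict ((*v) w) R"
      unfolding P_def by blast
    have "x = w *v (\<Sum>b\<in>R. c b *\<^sub>R b)" using fixed[OF w(1)] c by simp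
    also have "\<dots> = (\<Sum>b\<in>R. c b *\<^sub>R (w *v b))"
      by (simp add: linear_sum[OF matrix_vector_mul_linear] matrix_vector_mult_scaleR)
    finally show ?thesis by (simp add: w(2))
  qed
  have avg: "(\<Sum>p\<in>P. p b) = 0" if b: "b \<in> R" for b
  proof -
    \<comment> \<open>Right multiplication by s_b, transferred to the induced permutations of
      \<open>R\<close>. It is an involution of \<open>P\<close> that negates the value at
      \<open>b\<close>, so the average at \<open>b\<close> equals its own negative.\<close>
    define q where "q p = restrict (\<lambda>a. p (sref cor b *v a)) R" for p :: "real^'n \<Rightarrow> real^'n"
    have qP: "q p \<in> P" if "p \<in> P" for p
    proof -
      from that obtain w where w: "w \<in> W" "p = restrict ((*v) w) R"
        unfolding P_def by blast
      have "q p = restrict ((*v) (w ** sref cor b)) R"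
        unfolding q_def w(2)
        by (rule restrict_ext) (simp add: sref_root[OF b] matrix_vector_mul_assoc)
      then show ?thesis
        unfolding P_def using weyl_mult[OF w(1) sref_weyl[OF b]] by blast
    qed
    have qq: "q (q p) = p" if "p \<in> P" for p
    proof -
      from that have ext: "p \<in> extensional R" unfolding P_def by auto
      show ?thesis
        unfolding q_def
        by (rule extensionalityI[OF _ ext])
           (auto simp: sref_root[OF b] matrix_vector_mul_assoc sref_sref[OF b])
    qed
    have "(\<Sum>p\<in>P. p b) = (\<Sum>p\<in>P. q p b)"
      by (rule sum.reindex_bij_witness[of _ q q]) (auto simp: qP qq)
    also have "\<dots> = (\<Sum>p\<in>P. - p b)"
    proof (rule sum.cong)
      fix p assume "p \<in> P"
      then obtain w where w: "w \<in> W" "p = restrict ((*v) w) R"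
        unfolding P_def by blast
      show "q p b = - p b"
        using b by (simp add: q_def sref_self w(2) root_uminus linear_neg[OF matrix_vector_mul_linear])
    qed simp
    finally have "(\<Sum>p\<in>P. p b) + (\<Sum>p\<in>P. p b) = 0"
      by (simp add: sum_negf)
    then have "2 *\<^sub>R (\<Sum>p\<in>P. p b) = 0"
      unfolding scaleR_2 .
    then show ?thesis by simp
  qed
  have "real (card P) *\<^sub>R x = (\<Sum>p\<in>P. x)"
    by (simp only: sum_constant_scaleR)
  also have "\<dots> = (\<Sum>p\<in>P. \<Sum>b\<in>R. c b *\<^sub>R p b)"
    by (rule sum.cong[OF refl px])
  also have "\<dots> = (\<Sum>b\<in>R. c b *\<^sub>R (\<Sum>p\<in>P. p b))"
    by (subst sum.swap) (simp add: scaleR_sum_right)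
  also have "\<dots> = 0" by (simp add: avg)
  finally show ?thesis using \<open>card P > 0\<close> by simp
qed

text \<open>An element of \<open>W\<close> is determined by its permutation of \<open>R\<close>: if
  w and u agree on \<open>R\<close>, then w(v) - u(v) lies in the root span and, by
  \<open>weyl_pairing\<close>, is killed by every coroot, so \<open>span_roots_radical\<close>
  applies.\<close>

lemma finite_weyl: "finite W"
proof (rule inj_on_finite[where f = "\<lambda>w. restrict ((*v) w) R"])
  show "(\<lambda>w. restrict ((*v) w) R) ` W \<subseteq> R \<rightarrow>\<^sub>E R"
    using weyl_root by auto
  show "finite (R \<rightarrow>\<^sub>E R)" using finite_R by (simp add: finite_PiE)
  show "inj_on (\<lambda>w. restrict ((*v) w) R) W"
  proof (rule inj_onI)
    fix w u assume w: "w \<in> W" and u: "u \<in> W"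
      and eq: "restrict ((*v) w) R = restrict ((*v) u) R"
    have wu: "w *v b = u *v b" if "b \<in> R" for b
      using fun_cong[OF eq, of b] that by simp
    have "w *v v - u *v v = 0" for v
    proof (rule span_roots_radical)
      have "w *v v - u *v v = (w *v v - v) - (u *v v - v)" by simp
      then show "w *v v - u *v v \<in> span R"
        using span_diff[OF weyl_diff_span[OF w, of v] weyl_diff_span[OF u, of v]] by simp
      fix c assume c: "c \<in> R"
      define b where "b = matrix_inv w *v c"
      have b: "b \<in> R" "w *v b = c"
        unfolding b_def using weyl_root weyl_matrix_inv[OF w] c
        by (auto simp: matrix_vector_mul_assoc)
      show "(w *v v - u *v v) \<bullet> cor c = 0"
        using weyl_pairing[OF w b(1), of v] weyl_pairing[OF u b(1), of v] b wu
        by (simp add: inner_diff_left)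
    qed
    then show "w = u" by (simp add: matrix_eq)
  qed
qed

section \<open>An invariant inner product and positive roots\<close>

text \<open>The dot product only fixes coordinates and need not be preserved by \<open>W\<close>;
  averaging over the finite group yields an invariant inner product.\<close>

definition wform :: "real^'n \<Rightarrow> real^'n \<Rightarrow> real" where
  "wform x y = (\<Sum>w\<in>W. (w *v x) \<bullet> (w *v y))"

lemma wform_invariant:
  assumes u: "u \<in> W"
  shows "wform (u *v x) (u *v y) = wform x y"
  unfolding wform_def
  by (rule sum.reindex_bij_witness[of _ "\<lambda>w. w ** matrix_inv u" "\<lambda>w. w ** u"])
     (auto simp: weyl_mult u weyl_matrix_inv matrix_vector_mul_assoc matrix_mul_assoc[symmetric])

lemma wform_pos: "x \<noteq> 0 \<Longrightarrow> wform x x > 0"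
proof -
  assume x: "x \<noteq> 0"
  have "(mat 1 *v x) \<bullet> (mat 1 *v x) \<le> wform x x"
    unfolding wform_def
    by (rule member_le_sum[where f = "\<lambda>w. (w *v x) \<bullet> (w *v x)"]) (auto simp: weyl_one finite_weyl)
  then have "x \<bullet> x \<le> wform x x" by simp
  moreover have "x \<bullet> x > 0" using x by simp
  ultimately show ?thesis by linarith
qed

lemma wform_linear: "linear (wform x)"
  unfolding wform_def
  by (auto simp: linear_iff matrix_vector_right_distrib matrix_vector_mult_scaleR inner_add_right
      sum.distrib sum_distrib_left)

lemma wform_sym: "wform x y = wform y x"
  unfolding wform_def by (simp add: inner_commute)

text \<open>The familiar formula 2(x,a)/(a,a) for the coroot pairing, forced by invariance under s_a
  together with s_a(a) = -a. It transfers signs from the form to the pairing.\<close>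

lemma wform_coroot:
  assumes a: "a \<in> R"
  shows "2 * wform x a = (x \<bullet> cor a) * wform a a"
proof -
  have "wform (sref cor a *v x) (sref cor a *v a) = wform x a"
    using wform_invariant[OF sref_weyl[OF a]] .
  moreover have "wform (sref cor a *v x) (sref cor a *v a) = - wform a (sref cor a *v x)"
    by (simp add: sref_self[OF a] linear_neg[OF wform_linear] wform_sym[of a])
  ultimately show ?thesis
    by (simp add: sref_apply linear_diff[OF wform_linear] linear_cmul[OF wform_linear] wform_sym)
qed

lemma simple_coeff_unique:
  assumes "(\<Sum>d\<in>D. f d *\<^sub>R d) = (\<Sum>d\<in>D. g d *\<^sub>R d)" "d \<in> D"
  shows "f d = g d"
proof -
  have "(\<Sum>d\<in>D. (f d - g d) *\<^sub>R d) = 0"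
    using assms(1) by (simp add: scaleR_left_diff_distrib sum_subtractf)
  then have "f d - g d = 0"
    by (rule independentD[OF independent_D finite_D subset_refl _ assms(2)])
  then show ?thesis by simp
qed

lemma not_pos_uminus:
  assumes b: "b \<in> R" "pos b"
  shows "\<not> pos (- b)"
proof
  assume "pos (- b)"
  then obtain m m' where m: "b = (\<Sum>d\<in>D. real (m d) *\<^sub>R d)" "- b = (\<Sum>d\<in>D. real (m' d) *\<^sub>R d)"
    using b unfolding nonneg_int_comb_def by blast
  have "(\<Sum>d\<in>D. real (m d) *\<^sub>R d) = (\<Sum>d\<in>D. (- real (m' d)) *\<^sub>R d)"
    unfolding m(1)[symmetric] by (simp add: sum_negf m(2)[symmetric])
  then have "real (m d) = - real (m' d)" if "d \<in> D" for d
    using that by (rule simple_coeff_unique)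
  then have "m d = 0" if "d \<in> D" for d
    using that by fastforce
  then have "b = 0" using m(1) by simp
  then show False using b zero_not_root by simp
qed

lemma pos_simple: "d \<in> D \<Longrightarrow> pos d"
  unfolding nonneg_int_comb_def
  by (rule exI[of _ "\<lambda>x. if x = d then 1 else 0"])
     (simp add: finite_D if_distrib[of real] if_distrib[of "\<lambda>x. x *\<^sub>R _"] cong: if_cong)

text \<open>Reflecting in \<open>a\<close> changes only the coefficient at \<open>a\<close>. If the
  image were negative, all other coefficients of \<open>b\<close> would have to vanish;
  \<open>b\<close> would be a multiple of \<open>a\<close>, hence \<open>a\<close> itself because
  the root system is reduced.\<close>

lemma pos_sref_simple:
  assumes a: "a \<in> D" and b: "b \<in> R" "pos b" "b \<noteq> a"
  shows "pos (sref cor a *v b)"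
proof (rule ccontr)
  assume "\<not> ?thesis"
  then have "pos (- (sref cor a *v b))"
    using pos_or_neg sref_root[OF simple_root[OF a] b(1)] by blast
  then obtain m m' where m: "b = (\<Sum>d\<in>D. real (m d) *\<^sub>R d)"
    "- (sref cor a *v b) = (\<Sum>d\<in>D. real (m' d) *\<^sub>R d)"
    using b unfolding nonneg_int_comb_def by blast
  have "(\<Sum>d\<in>D. real (m d) *\<^sub>R d) = b" using m by simp
  also have "b = (b \<bullet> cor a) *\<^sub>R a - - (sref cor a *v b)"
    by (simp add: sref_apply)
  also have "\<dots> = (\<Sum>d\<in>D. (if d = a then b \<bullet> cor a else 0) *\<^sub>R d) - (\<Sum>d\<in>D. real (m' d) *\<^sub>R d)"
    unfolding m(2) using a by (simp add: finite_D if_distrib[of "\<lambda>x. x *\<^sub>R _"] cong: if_cong)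
  also have "\<dots> = (\<Sum>d\<in>D. ((if d = a then b \<bullet> cor a else 0) - real (m' d)) *\<^sub>R d)"
    by (simp add: scaleR_left_diff_distrib sum_subtractf)
  finally have "real (m d) = (if d = a then b \<bullet> cor a else 0) - real (m' d)" if "d \<in> D" for d
    using that by (rule simple_coeff_unique)
  from this have "m d = 0" if "d \<in> D" "d \<noteq> a" for d
    using that by fastforce
  then have "b = (\<Sum>d\<in>D. if d = a then real (m a) *\<^sub>R a else 0)"
    unfolding m(1) by (intro sum.cong) auto
  then have ba: "b = real (m a) *\<^sub>R a" using a finite_D by simp
  then have "real (m a) = 1 \<or> real (m a) = -1"
    using root_multiple[OF simple_root[OF a]] b(1) by blast
  then have "real (m a) = 1" using of_nat_0_le_iff[of "m a"] by linarith
  then show False using ba b(3) by simp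
qed

lemma word_prod_weyl: "set as \<subseteq> D \<Longrightarrow> wp as \<in> W"
  by (induction as) (auto intro: weyl_one weyl_step simple_root)

lemma word_prod_rev: "set as \<subseteq> D \<Longrightarrow> wp as ** wp (rev as) = mat 1"
proof (induction as)
  case (Cons a as)
  then have a: "sref cor a ** sref cor a = mat 1" and IH: "wp as ** wp (rev as) = mat 1"
    using sref_sref simple_root by auto
  have "wp (a # as) ** wp (rev (a # as)) = sref cor a ** (wp as ** wp (rev as)) ** sref cor a"
    by (simp add: word_prod_append matrix_mul_assoc)
  then show ?case by (simp add: IH a)
qed simp

text \<open>Induction on the height, the sum of the coefficients. Positivity of (b,b) yields a
  simple \<open>a\<close> occurring in \<open>b\<close> with (b,a) > 0; unless \<open>b\<close> is
  simple, its reflection in \<open>a\<close> is again positive and has smaller height.\<close>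

lemma pos_root_conj_simple:
  assumes "b \<in> R" "b = (\<Sum>d\<in>D. real (m d) *\<^sub>R d)"
  shows "\<exists>as d. set as \<subseteq> D \<and> d \<in> D \<and> b = wp as *v d"
  using assms
proof (induction "\<Sum>d\<in>D. m d" arbitrary: b m rule: less_induct)
  case less
  show ?case
  proof (cases "b \<in> D")
    case True
    then show ?thesis by (intro exI[of _ "[]"] exI[of _ b]) auto
  next
    case False
    have "b \<noteq> 0" using less.prems(1) zero_not_root by auto
    then have "0 < wform b b" by (rule wform_pos)
    moreover have "wform x (\<Sum>d\<in>D. real (m d) *\<^sub>R d) = (\<Sum>d\<in>D. real (m d) * wform x d)" for x
      by (simp add: linear_sum[OF wform_linear] linear_cmul[OF wform_linear])
    from this[of b] have "wform b b = (\<Sum>d\<in>D. real (m d) * wform b d)"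
      unfolding less.prems(2)[symmetric] .
    ultimately have "\<not> (\<Sum>d\<in>D. real (m d) * wform b d) \<le> 0" by simp
    then have "\<not> (\<forall>d\<in>D. real (m d) * wform b d \<le> 0)"
      by (auto intro: sum_nonpos)
    then obtain a where a: "a \<in> D" "real (m a) * wform b a > 0"
      by (auto simp: not_le)
    have aR: "a \<in> R" using a simple_root by blast
    have "wform b a > 0"
      using a(2) by (simp add: zero_less_mult_iff)
    then have bca: "b \<bullet> cor a > 0"
    proof -
      have "a \<noteq> 0" using aR zero_not_root by auto
      then have "wform a a > 0" by (rule wform_pos)
      moreover have "(b \<bullet> cor a) * wform a a > 0"
        using wform_coroot[OF aR, of b] \<open>wform b a > 0\<close> by linarith
      ultimately show ?thesis by (rule zero_less_mult_pos2[rotated])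
    qed
    have posb: "pos b" using less.prems(2) unfolding nonneg_int_comb_def by blast
    have "pos (sref cor a *v b)"
      using pos_sref_simple[OF a(1) less.prems(1) posb] False a(1) by blast
    then obtain m' where m': "sref cor a *v b = (\<Sum>d\<in>D. real (m' d) *\<^sub>R d)"
      unfolding nonneg_int_comb_def by blast
    \<comment> \<open>Only the coefficient at \<open>a\<close> changes, by the positive amount
      \<open>c\<close>. Uniqueness of coefficients turns this into a comparison of the natural
      numbers \<open>m'\<close> and \<open>m\<close>.\<close>
    define c where "c = b \<bullet> cor a"
    have "(\<Sum>d\<in>D. (real (m d) - (if d = a then c else 0)) *\<^sub>R d) =
        (\<Sum>d\<in>D. real (m d) *\<^sub>R d) - (\<Sum>d\<in>D. (if d = a then c else 0) *\<^sub>R d)"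
      by (simp add: scaleR_left_diff_distrib sum_subtractf)
    also have "(\<Sum>d\<in>D. (if d = a then c else 0) *\<^sub>R d) = c *\<^sub>R a"
      using a(1) by (simp add: finite_D if_distrib[of "\<lambda>x. x *\<^sub>R _"] cong: if_cong)
    finally have "(\<Sum>d\<in>D. real (m' d) *\<^sub>R d) =
        (\<Sum>d\<in>D. (real (m d) - (if d = a then c else 0)) *\<^sub>R d)"
      unfolding m'[symmetric] less.prems(2)[symmetric] by (simp add: sref_apply c_def)
    then have co: "real (m' d) = real (m d) - (if d = a then c else 0)" if "d \<in> D" for d
      using that by (rule simple_coeff_unique)
    have pr: "c > 0" using bca by (simp add: c_def)
    have "(\<Sum>d\<in>D. m' d) < (\<Sum>d\<in>D. m d)"
    proof (rule sum_strict_mono_ex1[OF finite_D])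
      have "real (m' d) \<le> real (m d)" if "d \<in> D" for d
        using co[OF that] pr by (simp split: if_splits)
      then show "\<forall>d\<in>D. m' d \<le> m d" by simp
      show "\<exists>d\<in>D. m' d < m d"
        using co[OF a(1)] pr a(1) by (intro bexI[of _ a]) auto
    qed
    from less.hyps[OF this sref_root[OF aR less.prems(1)] m']
    obtain as d where "set as \<subseteq> D" "d \<in> D" "sref cor a *v b = wp as *v d" by blast
    moreover have "sref cor a *v (sref cor a *v b) = b"
      by (simp add: matrix_vector_mul_assoc sref_sref[OF aR])
    ultimately have "set (a # as) \<subseteq> D \<and> d \<in> D \<and> b = wp (a # as) *v d"
      using a(1) by (simp add: matrix_vector_mul_assoc[symmetric])
    then show ?thesis by blast
  qed
qed

section \<open>Generation by simple reflections\<close>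

text \<open>If b = w(d) with d simple, then s_b is the conjugate of s_d by w, and the inverse of w
  is the reversed word because the letters are involutions. A negative root shares its reflection
  with its opposite.\<close>

lemma sref_word:
  assumes b: "b \<in> R"
  shows "\<exists>as. set as \<subseteq> D \<and> sref cor b = wp as"
proof -
  have *: "\<exists>as. set as \<subseteq> D \<and> sref cor b = wp as" if b: "b \<in> R" "pos b" for b
  proof -
    obtain m where "b = (\<Sum>d\<in>D. real (m d) *\<^sub>R d)"
      using b(2) unfolding nonneg_int_comb_def by blast
    from pos_root_conj_simple[OF b(1) this]
    obtain as d where as: "set as \<subseteq> D" "d \<in> D" "b = wp as *v d" by blast
    have "sref cor b ** wp as = wp as ** sref cor d"
      using sref_conj[OF word_prod_weyl[OF as(1)] simple_root[OF as(2)]] as(3) by simp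
    then have "sref cor b ** (wp as ** wp (rev as)) = wp as ** sref cor d ** wp (rev as)"
      by (simp add: matrix_mul_assoc)
    then have "sref cor b = wp (as @ [d] @ rev as)"
      by (simp add: word_prod_rev[OF as(1)] word_prod_append matrix_mul_assoc)
    then show ?thesis using as by (intro exI[of _ "as @ [d] @ rev as"]) auto
  qed
  show ?thesis
    using *[OF b] *[OF root_uminus[OF b]] pos_or_neg[OF b] unfolding sref_uminus[OF b] by blast
qed

lemma weyl_word: "w \<in> W \<Longrightarrow> \<exists>as. set as \<subseteq> D \<and> w = wp as"
proof (induction rule: weyl.induct)
  case weyl_one
  show ?case by (intro exI[of _ "[]"]) auto
next
  case (weyl_step a w)
  then obtain as bs where "set as \<subseteq> D" "w = wp as" "set bs \<subseteq> D" "sref cor a = wp bs"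
    using sref_word by blast
  then show ?case by (intro exI[of _ "bs @ as"]) (auto simp: word_prod_append)
qed

section \<open>Exchange, length and the longest element\<close>

text \<open>Letting the letters act on \<open>a\<close> from the right, there is a letter
  \<open>b\<close> at which the root turns from positive to negative. By
  \<open>pos_sref_simple\<close> the root just before must be \<open>b\<close> itself, so
  conjugation carries s_a to s_b, which cancels that letter.\<close>

lemma exchange:
  assumes "set as \<subseteq> D" "a \<in> D" "\<not> pos (wp as *v a)"
  shows "\<exists>bs. set bs \<subseteq> D \<and> length as = Suc (length bs) \<and> wp as ** sref cor a = wp bs"
  using assms
proof (induction as)
  case Nil
  then show ?case using pos_simple by simp
next
  case (Cons b as)
  have aR: "a \<in> R" and bD: "b \<in> D" and as: "set as \<subseteq> D"
    using Cons.prems simple_root by auto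
  have as_W: "wp as \<in> W" using word_prod_weyl[OF as] .
  show ?case
  proof (cases "pos (wp as *v a)")
    case True
    have "wp as *v a = b"
    proof (rule ccontr)
      assume "wp as *v a \<noteq> b"
      from pos_sref_simple[OF bD weyl_root[OF as_W aR] True this]
      show False using Cons.prems(3) by (simp add: matrix_vector_mul_assoc)
    qed
    then have "wp as ** sref cor a = sref cor b ** wp as"
      using sref_conj[OF as_W aR] by simp
    then have "wp (b # as) ** sref cor a = wp as ** (sref cor a ** sref cor a)"
      by (simp add: matrix_mul_assoc)
    then have "wp (b # as) ** sref cor a = wp as"
      by (simp add: sref_sref[OF aR])
    then show ?thesis using as by auto
  next
    case False
    then obtain bs where "set bs \<subseteq> D" "length as = Suc (length bs)" "wp as ** sref cor a = wp bs"
      using Cons.IH[OF as Cons.prems(2)] by blast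
    then show ?thesis using bD
      by (intro exI[of _ "b # bs"]) (auto simp: matrix_mul_assoc[symmetric])
  qed
qed

lemma wlen_word:
  assumes "w \<in> W"
  shows "\<exists>as. length as = wlen cor D w \<and> set as \<subseteq> D \<and> w = wp as"
  unfolding wlen_def
  unfolding word_prod_def[symmetric]
  by (rule LeastI_ex) (use weyl_word[OF assms] in blast)

lemma wlen_le: "set as \<subseteq> D \<Longrightarrow> wlen cor D (wp as) \<le> length as"
  unfolding wlen_def by (rule Least_le) (auto simp: word_prod_def)

lemma wlen_decrease:
  assumes w: "w \<in> W" and a: "a \<in> D" "\<not> pos (w *v a)"
  shows "wlen cor D (w ** sref cor a) < wlen cor D w"
proof -
  obtain as where as: "length as = wlen cor D w" "set as \<subseteq> D" "w = wp as"
    using wlen_word[OF w] by blast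
  obtain bs where "set bs \<subseteq> D" "length as = Suc (length bs)" "wp as ** sref cor a = wp bs"
    using exchange[OF as(2) a(1)] a(2) as(3) by blast
  then show ?thesis using wlen_le[of bs] as by simp
qed

text \<open>The product w s_a sends \<open>a\<close> to the negative root -w(a), so
  \<open>wlen_decrease\<close> applies to it, and multiplying by s_a once more gives back w.\<close>

lemma wlen_increase:
  assumes w: "w \<in> W" and a: "a \<in> D" "pos (w *v a)"
  shows "wlen cor D w < wlen cor D (w ** sref cor a)"
proof -
  have aR: "a \<in> R" using a simple_root by blast
  have "(w ** sref cor a) *v a = - (w *v a)"
    by (simp add: matrix_vector_mul_assoc[symmetric] sref_self[OF aR]
        linear_neg[OF matrix_vector_mul_linear])
  then have "\<not> pos ((w ** sref cor a) *v a)"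
    using not_pos_uminus[OF weyl_root[OF w aR] a(2)] by simp
  from wlen_decrease[OF weyl_mult[OF w sref_weyl[OF aR]] a(1) this]
  show ?thesis by (simp add: matrix_mul_assoc[symmetric] sref_sref[OF aR])
qed

text \<open>A nonempty shortest word for \<open>u\<close> has a last letter \<open>a\<close>.
  Multiplying by s_a deletes it and shortens the word, whereas positivity of u(a) makes the length
  grow.\<close>

lemma pos_preserving_trivial:
  assumes u: "u \<in> W" and pos: "\<And>a. a \<in> D \<Longrightarrow> pos (u *v a)"
  shows "u = mat 1"
proof -
  obtain as where as: "length as = wlen cor D u" "set as \<subseteq> D" "u = wp as"
    using wlen_word[OF u] by blast
  show ?thesis
  proof (cases as rule: rev_cases)
    case Nil
    then show ?thesis using as by simp
  next
    case (snoc bs a)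
    then have a: "a \<in> D" "set bs \<subseteq> D" using as by auto
    have "u ** sref cor a = wp bs"
      using as(3) snoc sref_sref[OF simple_root[OF a(1)]]
      by (simp add: word_prod_append matrix_mul_assoc[symmetric])
    then have "wlen cor D (u ** sref cor a) \<le> length bs"
      using wlen_le[OF a(2)] by simp
    then show ?thesis
      using wlen_increase[OF u a(1) pos[OF a(1)]] as(1) snoc by simp
  qed
qed

lemma pos_sum:
  assumes "\<And>d. d \<in> S \<Longrightarrow> pos (g d)" "finite S"
  shows "pos (\<Sum>d\<in>S. real (m d) *\<^sub>R g d)"
proof -
  obtain M where M: "\<And>d. d \<in> S \<Longrightarrow> g d = (\<Sum>e\<in>D. real (M d e) *\<^sub>R e)"
    using assms(1) unfolding nonneg_int_comb_def by metis
  have "(\<Sum>d\<in>S. real (m d) *\<^sub>R g d) = (\<Sum>d\<in>S. \<Sum>e\<in>D. (real (m d) * real (M d e)) *\<^sub>R e)"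
    by (intro sum.cong refl) (simp add: M scaleR_sum_right)
  also have "\<dots> = (\<Sum>e\<in>D. real (\<Sum>d\<in>S. m d * M d e) *\<^sub>R e)"
    by (subst sum.swap) (simp add: scaleR_sum_left)
  finally show ?thesis
    unfolding nonneg_int_comb_def by (intro exI[of _ "\<lambda>e. \<Sum>d\<in>S. m d * M d e"])
qed

text \<open>\<open>longest\<close> is a definite description, so existence and uniqueness are both
  required. An element of maximal length sends every positive root to a negative one by
  \<open>wlen_increase\<close>. For two such elements w and v, the quotient of v by w keeps simple
  roots positive and is therefore trivial.\<close>

lemma longest_weyl: "longest R cor D \<in> W"
proof -
  let ?P = "\<lambda>w. w \<in> W \<and> (\<forall>u\<in>W. wlen cor D u \<le> wlen cor D w)"
  have ex: "\<exists>w. ?P w"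
  proof -
    have "Max (wlen cor D ` W) \<in> wlen cor D ` W"
      using finite_weyl weyl_one by (intro Max_in) auto
    then obtain w where "w \<in> W" "wlen cor D w = Max (wlen cor D ` W)" by auto
    then show ?thesis using finite_weyl by (intro exI[of _ w]) auto
  qed
  have neg: "pos (- (w *v b))" if "?P w" "b \<in> R" "pos b" for w b
  proof -
    have "pos (- (w *v a))" if a: "a \<in> D" for a
    proof -
      have w: "w \<in> W" using \<open>?P w\<close> by blast
      have "wlen cor D (w ** sref cor a) \<le> wlen cor D w"
        using \<open>?P w\<close> weyl_mult[OF w sref_weyl[OF simple_root[OF a]]] by blast
      then have "\<not> pos (w *v a)" using wlen_increase[OF w a] by linarith
      then show ?thesis using pos_or_neg[OF weyl_root[OF w simple_root[OF a]]] by blast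
    qed
    moreover obtain m where m: "b = (\<Sum>d\<in>D. real (m d) *\<^sub>R d)"
      using \<open>pos b\<close> unfolding nonneg_int_comb_def by blast
    moreover have "- (w *v b) = (\<Sum>d\<in>D. real (m d) *\<^sub>R (- (w *v d)))"
      unfolding m
      by (simp add: linear_sum[OF matrix_vector_mul_linear] matrix_vector_mult_scaleR sum_negf)
    ultimately show ?thesis using pos_sum[of D "\<lambda>d. - (w *v d)" m] finite_D by simp
  qed
  have uniq: "w = v" if w: "?P w" and v: "?P v" for w v
  proof -
    let ?i = "matrix_inv w"
    have "?i ** v = mat 1"
    proof (rule pos_preserving_trivial)
      show iv: "?i ** v \<in> W" using w v weyl_matrix_inv weyl_mult by blast
      fix a assume a: "a \<in> D"
      have aR: "a \<in> R" using simple_root a by blast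
      let ?c = "(?i ** v) *v a"
      have cR: "?c \<in> R" using weyl_root[OF iv aR] .
      have wc: "w *v ?c = v *v a"
        using weyl_matrix_inv[of w] w by (simp add: matrix_vector_mul_assoc matrix_mul_assoc)
      show "pos ?c"
      proof (rule ccontr)
        assume "\<not> pos ?c"
        then have "pos (- ?c)" using pos_or_neg[OF cR] by blast
        from neg[OF w root_uminus[OF cR] this] have "pos (v *v a)"
          by (simp add: linear_neg[OF matrix_vector_mul_linear] wc)
        then show False
          using neg[OF v aR pos_simple[OF a]] not_pos_uminus weyl_root[OF _ aR] v by blast
      qed
    qed
    then have "w ** ?i ** v = w" by (simp add: matrix_mul_assoc[symmetric])
    then show ?thesis using weyl_matrix_inv[of w] w by simp
  qed
  show ?thesis
    unfolding longest_def using theI'[of ?P] ex uniq by blast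
qed

end

section \<open>Traces on quotients and the Hopf trace formula\<close>

text \<open>A copy of \<open>vector_space\<close> without its global interpretations, which would capture the names
  declared here.\<close>

locale linear_space = vector_space
begin

text \<open>Finite dimension is stated for a subspace because the cochains live among all functions
  on sequences of vectors, an infinite-dimensional space.\<close>

definition fin_dim :: "'b set \<Rightarrow> bool" where
  "fin_dim U \<longleftrightarrow> subspace U \<and> (\<exists>A. finite A \<and> U \<subseteq> span A)"

definition trace_on :: "('b \<Rightarrow> 'b) \<Rightarrow> 'b set \<Rightarrow> 'a" where
  "trace_on T U = (let B = (SOME B. finite B \<and> independent B \<and> span B = U)
     in \<Sum>b\<in>B. representation B (T b) b)"

text \<open>A frame of \<open>U\<close> expresses the identity of \<open>U\<close> as a finite sum of rank one operators
  \<open>x \<mapsto> \<phi>\<^sub>k(x) e\<^sub>k\<close>. The vectors \<open>e\<^sub>k\<close> need not be independent, yet traces can be computed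
  from them as from a basis.\<close>

definition frame :: "'b set \<Rightarrow> 'k set \<Rightarrow> ('k \<Rightarrow> 'b) \<Rightarrow> ('k \<Rightarrow> 'b \<Rightarrow> 'a) \<Rightarrow> bool" where
  "frame U K e \<phi> \<longleftrightarrow> finite K \<and> (\<forall>k\<in>K. e k \<in> U) \<and>
     (\<forall>k\<in>K. \<forall>x\<in>U. \<forall>y\<in>U. \<phi> k (x + y) = \<phi> k x + \<phi> k y) \<and>
     (\<forall>k\<in>K. \<forall>c. \<forall>x\<in>U. \<phi> k (scale c x) = c * \<phi> k x) \<and>
     (\<forall>x\<in>U. x = (\<Sum>k\<in>K. scale (\<phi> k x) (e k)))"

lemma frame_sum:
  assumes U: "subspace U" and fr: "frame U K e \<phi>" and k: "k \<in> K" and x: "\<And>i. i \<in> I \<Longrightarrow> x i \<in> U"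
  shows "\<phi> k (\<Sum>i\<in>I. scale (c i) (x i)) = (\<Sum>i\<in>I. c i * \<phi> k (x i))"
  using x
proof (induction I rule: infinite_finite_induct)
  case (insert i I)
  have "(\<Sum>i\<in>I. scale (c i) (x i)) \<in> U"
    using insert.prems U by (intro subspace_sum subspace_scale) auto
  moreover have "scale (c i) (x i) \<in> U"
    using insert.prems U by (intro subspace_scale) auto
  ultimately show ?case
    using insert fr k unfolding frame_def by simp
next
  case empty
  have "\<phi> k (scale 0 0) = 0 * \<phi> k 0"
    using fr k subspace_0[OF U] unfolding frame_def by blast
  then show ?case by simp
next
  case (infinite A)
  have "\<phi> k (scale 0 0) = 0 * \<phi> k 0"
    using fr k subspace_0[OF U] unfolding frame_def by blast
  then show ?case using infinite by simp
qed

text \<open>This is tr(AB) = tr(BA): expanding each \<open>e k\<close> in the second frame and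
  collecting in the first gives the same double sum over
  \<open>\<phi> k (T (f l)) * \<psi> l (e k)\<close>. It makes the basis chosen in
  \<open>trace_on\<close> immaterial.\<close>

lemma frame_trace_unique:
  assumes U: "subspace U" and e: "frame U K e \<phi>" and f: "frame U L f \<psi>"
    and T: "Vector_Spaces.linear scale scale T" "T ` U \<subseteq> U"
  shows "(\<Sum>k\<in>K. \<phi> k (T (e k))) = (\<Sum>l\<in>L. \<psi> l (T (f l)))"
proof -
  interpret T: Vector_Spaces.linear scale scale T by fact
  have eU: "\<And>k. k \<in> K \<Longrightarrow> e k \<in> U" and fU: "\<And>l. l \<in> L \<Longrightarrow> f l \<in> U"
    and ex: "\<And>x. x \<in> U \<Longrightarrow> (\<Sum>k\<in>K. scale (\<phi> k x) (e k)) = x"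
    and fx: "\<And>x. x \<in> U \<Longrightarrow> (\<Sum>l\<in>L. scale (\<psi> l x) (f l)) = x"
    using e f unfolding frame_def by auto
  have "(\<Sum>k\<in>K. \<phi> k (T (e k))) = (\<Sum>k\<in>K. \<Sum>l\<in>L. \<psi> l (e k) * \<phi> k (T (f l)))"
  proof (rule sum.cong[OF refl])
    fix k assume k: "k \<in> K"
    have "\<phi> k (T (e k)) = \<phi> k (T (\<Sum>l\<in>L. scale (\<psi> l (e k)) (f l)))"
      by (simp add: fx eU k)
    also have "\<dots> = \<phi> k (\<Sum>l\<in>L. scale (\<psi> l (e k)) (T (f l)))"
      by (simp add: T.sum T.scale)
    also have "\<dots> = (\<Sum>l\<in>L. \<psi> l (e k) * \<phi> k (T (f l)))"
      by (rule frame_sum[OF U e k]) (use fU T(2) in auto)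
    finally show "\<phi> k (T (e k)) = (\<Sum>l\<in>L. \<psi> l (e k) * \<phi> k (T (f l)))" .
  qed
  also have "\<dots> = (\<Sum>l\<in>L. \<Sum>k\<in>K. \<phi> k (T (f l)) * \<psi> l (e k))"
    by (subst sum.swap) (simp add: mult.commute)
  also have "\<dots> = (\<Sum>l\<in>L. \<psi> l (T (f l)))"
  proof (rule sum.cong[OF refl])
    fix l assume l: "l \<in> L"
    have "(\<Sum>k\<in>K. \<phi> k (T (f l)) * \<psi> l (e k)) = \<psi> l (\<Sum>k\<in>K. scale (\<phi> k (T (f l))) (e k))"
      by (rule frame_sum[OF U f l, symmetric]) (rule eU)
    also have "\<dots> = \<psi> l (T (f l))"
      using T(2) fU[OF l] by (subst ex) auto
    finally show "(\<Sum>k\<in>K. \<phi> k (T (f l)) * \<psi> l (e k)) = \<psi> l (T (f l))" .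
  qed
  finally show ?thesis .
qed

lemma frame_basis:
  assumes "finite B" "independent B"
  shows "frame (span B) B (\<lambda>b. b) (\<lambda>b x. representation B x b)"
  using assms unfolding frame_def
  by (auto simp: span_base representation_add representation_scale sum_representation_eq)

lemma fin_dim_basis_extend:
  assumes U: "fin_dim U" and S: "S \<subseteq> U" "independent S"
  obtains B where "S \<subseteq> B" "finite B" "independent B" "span B = U"
proof -
  obtain A where A: "finite A" "U \<subseteq> span A" and sU: "subspace U"
    using U unfolding fin_dim_def by blast
  obtain B where B: "S \<subseteq> B" "B \<subseteq> U" "independent B" "U \<subseteq> span B"
    using maximal_independent_subset_extend[OF S] .
  have "finite B" using independent_span_bound[OF A(1) B(3)] A(2) B(2) by blast
  moreover have "span B = U" using span_minimal[OF B(2) sU] B(4) by blast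
  ultimately show ?thesis using that B by blast
qed

lemma fin_dim_subspace:
  assumes "fin_dim U" "subspace V" "V \<subseteq> U"
  shows "fin_dim V"
  using assms unfolding fin_dim_def by blast

lemma trace_on_frame:
  assumes U: "subspace U" and e: "frame U K e \<phi>"
    and T: "Vector_Spaces.linear scale scale T" "T ` U \<subseteq> U"
  shows "trace_on T U = (\<Sum>k\<in>K. \<phi> k (T (e k)))"
proof -
  let ?P = "\<lambda>B. finite B \<and> independent B \<and> span B = U"
  have "U \<subseteq> span (e ` K)"
  proof
    fix x assume "x \<in> U"
    then have "x = (\<Sum>k\<in>K. scale (\<phi> k x) (e k))" using e unfolding frame_def by blast
    also have "\<dots> \<in> span (e ` K)" by (intro span_sum span_scale span_base) auto
    finally show "x \<in> span (e ` K)" .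
  qed
  moreover have "finite (e ` K)" using e unfolding frame_def by blast
  ultimately have "fin_dim U" unfolding fin_dim_def using U by blast
  from fin_dim_basis_extend[OF this, of "{}"] have "\<exists>B. ?P B"
    using independent_empty by blast
  from someI_ex[OF this] have B: "?P (SOME B. ?P B)" .
  define B where "B = (SOME B. ?P B)"
  have B: "finite B" "independent B" "span B = U" using B unfolding B_def by auto
  have "trace_on T U = (\<Sum>b\<in>B. representation B (T b) b)"
    unfolding trace_on_def B_def[symmetric] by simp
  also have "\<dots> = (\<Sum>k\<in>K. \<phi> k (T (e k)))"
    by (rule frame_trace_unique[OF U _ e T]) (use frame_basis[OF B(1,2)] B(3) in simp)
  finally show ?thesis .
qed

lemma trace_on_basis:
  assumes B: "finite B" "independent B" and T: "Vector_Spaces.linear scale scale T"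
    and stable: "T ` span B \<subseteq> span B"
  shows "trace_on T (span B) = (\<Sum>b\<in>B. representation B (T b) b)"
  by (rule trace_on_frame[OF subspace_span frame_basis[OF B] T stable])

text \<open>With respect to \<open>S\<close> followed by \<open>C\<close> the operator is block
  triangular, since it preserves \<open>span S\<close>; the sum over \<open>C\<close> is the trace
  on the quotient.\<close>

lemma trace_on_split:
  assumes B: "finite (S \<union> C)" "independent (S \<union> C)" "S \<inter> C = {}"
    and T: "Vector_Spaces.linear scale scale T"
    and stable: "T ` span (S \<union> C) \<subseteq> span (S \<union> C)" "T ` span S \<subseteq> span S"
  shows "trace_on T (span (S \<union> C))
    = trace_on T (span S) + (\<Sum>c\<in>C. representation (S \<union> C) (T c) c)"
proof -
  have S: "finite S" "independent S" using B independent_mono by auto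
  have "trace_on T (span (S \<union> C)) = (\<Sum>b\<in>S \<union> C. representation (S \<union> C) (T b) b)"
    by (rule trace_on_basis[OF B(1,2) T stable(1)])
  also have "\<dots> = (\<Sum>b\<in>S. representation (S \<union> C) (T b) b) + (\<Sum>c\<in>C. representation (S \<union> C) (T c) c)"
    using B by (intro sum.union_disjoint) auto
  also have "(\<Sum>b\<in>S. representation (S \<union> C) (T b) b) = (\<Sum>b\<in>S. representation S (T b) b)"
  proof (rule sum.cong[OF refl])
    fix b assume "b \<in> S"
    then have "T b \<in> span S" using stable(2) span_base by blast
    then show "representation (S \<union> C) (T b) b = representation S (T b) b"
      using representation_extend[OF B(2), of "T b" S] by simp
  qed
  also have "\<dots> = trace_on T (span S)"
    by (rule trace_on_basis[OF S T stable(2), symmetric])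
  finally show ?thesis .
qed

text \<open>Any admissible pair of bases, whichever one the choice returns, gives the difference of
  traces by \<open>trace_on_split\<close>. Extending a basis of \<open>V\<close> to one of
  \<open>U\<close> shows that an admissible pair exists.\<close>

lemma quot_trace_eq:
  assumes U: "fin_dim U" and V: "subspace V" "V \<subseteq> U"
    and T: "Vector_Spaces.linear scale scale T" and stable: "T ` U \<subseteq> U" "T ` V \<subseteq> V"
  shows "quot_trace scale T U V = trace_on T U - trace_on T V"
proof -
  let ?Q = "\<lambda>P. fst P \<subseteq> V \<and> fst P \<inter> snd P = {} \<and> finite (fst P \<union> snd P) \<and>
    independent (fst P \<union> snd P) \<and> span (fst P) = V \<and> span (fst P \<union> snd P) = U"
  obtain S where S: "finite S" "independent S" "span S = V"
    using fin_dim_basis_extend[OF fin_dim_subspace[OF U V] empty_subsetI independent_empty] by metis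
  have SV: "S \<subseteq> V" using S(3) span_superset by blast
  obtain B where B: "S \<subseteq> B" "finite B" "independent B" "span B = U"
    using fin_dim_basis_extend[OF U _ S(2)] SV V(2) by blast
  have "S \<union> (B - S) = B" using B(1) by blast
  then have "?Q (S, B - S)" using S B SV by auto
  then have Q: "?Q (SOME P. ?Q P)" by (rule someI)
  define P where "P = (SOME P. ?Q P)"
  have P: "?Q P" unfolding P_def by (rule Q)
  have "quot_trace scale T U V = (\<Sum>c\<in>snd P. representation (fst P \<union> snd P) (T c) c)"
    unfolding quot_trace_def P_def[symmetric] by simp
  moreover have "trace_on T (span (fst P \<union> snd P)) = trace_on T (span (fst P)) +
      (\<Sum>c\<in>snd P. representation (fst P \<union> snd P) (T c) c)"
    by (rule trace_on_split[OF _ _ _ T]) (use P stable in auto)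
  ultimately show ?thesis using P by simp
qed

text \<open>Rank-nullity with traces. A complement \<open>C\<close> of a basis of the kernel maps
  under \<open>d\<close> to a frame of the image, and the diagonal entries of \<open>T\<close> at
  \<open>C\<close> agree upstairs and downstairs because \<open>T\<close> commutes with
  \<open>d\<close>.\<close>

lemma trace_on_kernel_image:
  assumes U: "fin_dim U" and d: "Vector_Spaces.linear scale scale d"
    and T: "Vector_Spaces.linear scale scale T" and stable: "T ` U \<subseteq> U"
    and comm: "\<And>x. x \<in> U \<Longrightarrow> d (T x) = T (d x)"
  shows "trace_on T U = trace_on T {x \<in> U. d x = 0} + trace_on T (d ` U)"
proof -
  interpret d: Vector_Spaces.linear scale scale d by fact
  interpret T: Vector_Spaces.linear scale scale T by fact
  have sU: "subspace U" using U unfolding fin_dim_def by blast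
  let ?Z = "{x \<in> U. d x = 0}"
  have sZ: "subspace ?Z"
    using sU unfolding subspace_def by (auto simp: d.add d.scale)
  obtain S where S: "finite S" "independent S" "span S = ?Z"
    using fin_dim_basis_extend[OF fin_dim_subspace[OF U sZ Collect_restrict] empty_subsetI independent_empty]
    by metis
  have SU: "S \<subseteq> U" using S(3) span_superset by blast
  obtain B where B: "S \<subseteq> B" "finite B" "independent B" "span B = U"
    using fin_dim_basis_extend[OF U SU S(2)] by blast
  define C where "C = B - S"
  have BSC: "S \<union> C = B" and disj: "S \<inter> C = {}" using B(1) unfolding C_def by auto
  have BU: "B \<subseteq> U" using B(4) span_superset by blast
  let ?r = "representation B"
  have r0: "?r x c = 0" if x: "x \<in> U" "d x = 0" and c: "c \<in> C" for x c
  proof -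
    have "x \<in> span S" using x S(3) by simp
    then have "?r x c = representation S x c"
      using representation_extend[OF B(3) _ B(1)] by simp
    also have "\<dots> = 0" using representation_ne_zero[of S x c] c C_def by blast
    finally show ?thesis .
  qed
  \<comment> \<open>An arbitrary preimage, not a linear section. Two preimages differ by a kernel
    element, which has no \<open>C\<close>-coordinates by \<open>r0\<close>, so the coordinates of
    \<open>lft y\<close> along \<open>C\<close> are well defined and linear in y.\<close>
  define lft where "lft y = (SOME x. x \<in> U \<and> d x = y)" for y
  have lft: "lft y \<in> U" "d (lft y) = y" if "y \<in> d ` U" for y
    using someI_ex[of "\<lambda>x. x \<in> U \<and> d x = y"] that unfolding lft_def by auto
  have rl: "?r (lft (d x)) c = ?r x c" if x: "x \<in> U" and c: "c \<in> C" for x c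
  proof -
    have l: "lft (d x) \<in> U" "d (lft (d x)) = d x" using lft x by auto
    have "?r (lft (d x) - x) c = 0"
      by (rule r0[OF _ _ c]) (use l x sU in \<open>auto simp: subspace_diff d.diff\<close>)
    moreover have "?r (lft (d x) - x) c = ?r (lft (d x)) c - ?r x c"
      using representation_diff[OF B(3), of x "lft (d x)"] l x B(4) by simp
    ultimately show ?thesis by simp
  qed
  have sdU: "subspace (d ` U)" using d.subspace_image[OF sU] .
  have fr: "frame (d ` U) C d (\<lambda>c y. ?r (lft y) c)"
    unfolding frame_def
  proof (intro conjI ballI allI)
    show "finite C" using B(2) unfolding C_def by simp
    show "d c \<in> d ` U" if "c \<in> C" for c using that BU unfolding C_def by blast
    show "?r (lft (x + y)) c = ?r (lft x) c + ?r (lft y) c"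
      if "c \<in> C" and xy: "x \<in> d ` U" "y \<in> d ` U" for c x y
    proof -
      obtain a b where ab: "a \<in> U" "b \<in> U" "x = d a" "y = d b" using xy by blast
      have "a + b \<in> U" using ab sU by (simp add: subspace_add)
      moreover have "x + y = d (a + b)" by (simp add: ab d.add)
      ultimately show ?thesis
        using ab \<open>c \<in> C\<close> B(3,4) by (simp add: rl representation_add)
    qed
    show "?r (lft (scale t x)) c = t * ?r (lft x) c" if "c \<in> C" and x: "x \<in> d ` U" for c t x
    proof -
      obtain a where a: "a \<in> U" "x = d a" using x by blast
      have "scale t a \<in> U" using a sU by (simp add: subspace_scale)
      moreover have "scale t x = d (scale t a)" by (simp add: a d.scale)
      ultimately show ?thesis
        using a \<open>c \<in> C\<close> B(3,4) by (simp add: rl representation_scale)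
    qed
    show "y = (\<Sum>c\<in>C. scale (?r (lft y) c) (d c))" if y: "y \<in> d ` U" for y
    proof -
      obtain x where x: "x \<in> U" "y = d x" using y by blast
      have "y = d (\<Sum>b\<in>B. scale (?r x b) b)"
        using x B by (simp add: sum_representation_eq)
      also have "\<dots> = (\<Sum>b\<in>B. scale (?r x b) (d b))" by (simp add: d.sum d.scale)
      also have "\<dots> = (\<Sum>b\<in>C. scale (?r x b) (d b))"
      proof (rule sum.mono_neutral_right)
        show "\<forall>b\<in>B - C. scale (?r x b) (d b) = 0"
        proof
          fix b assume "b \<in> B - C"
          then have "b \<in> span S" using C_def span_base by blast
          then show "scale (?r x b) (d b) = 0" using S(3) by simp
        qed
      qed (use B(2) C_def in auto)
      also have "\<dots> = (\<Sum>c\<in>C. scale (?r (lft y) c) (d c))"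
        by (rule sum.cong[OF refl]) (simp add: x rl)
      finally show ?thesis .
    qed
  qed
  have "trace_on T (d ` U) = (\<Sum>c\<in>C. ?r (lft (T (d c))) c)"
  proof (rule trace_on_frame[OF sdU fr T])
    show "T ` d ` U \<subseteq> d ` U"
      using stable comm by (auto simp: comm[symmetric])
  qed
  also have "\<dots> = (\<Sum>c\<in>C. ?r (T c) c)"
  proof (rule sum.cong[OF refl])
    fix c assume c: "c \<in> C"
    then have "c \<in> U" using BU C_def by blast
    then have "T (d c) = d (T c)" "T c \<in> U" using comm stable by auto
    then show "?r (lft (T (d c))) c = ?r (T c) c" using rl c by simp
  qed
  finally have 1: "trace_on T (d ` U) = (\<Sum>c\<in>C. ?r (T c) c)" .
  have "trace_on T (span (S \<union> C)) = trace_on T (span S) + (\<Sum>c\<in>C. representation (S \<union> C) (T c) c)"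
  proof (rule trace_on_split[OF _ _ disj T])
    show "T ` span S \<subseteq> span S"
      unfolding S(3) using stable by (auto simp: comm)
  qed (use B BSC stable in auto)
  then show ?thesis using 1 BSC B(4) S(3) by simp
qed

lemma trace_on_zero:
  assumes T: "Vector_Spaces.linear scale scale T"
  shows "trace_on T {0} = 0"
proof -
  interpret T: Vector_Spaces.linear scale scale T by fact
  have "trace_on T (span {}) = 0"
    by (subst trace_on_basis[OF _ _ T]) (auto simp: independent_empty T.zero)
  then show ?thesis by simp
qed

text \<open>The trace on cocycles modulo coboundaries is tr Z_i - tr B_i, while that on C_i is tr
  Z_i + tr B_(i+1). In the alternating sum the boundary terms telescope.\<close>

lemma euler_trace:
  fixes C :: "nat \<Rightarrow> 'b set" and d :: "nat \<Rightarrow> 'b \<Rightarrow> 'b"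
  assumes C: "\<And>i. fin_dim (C i)" and top: "C (Suc n) = {0}"
    and d: "\<And>i. Vector_Spaces.linear scale scale (d i)" "\<And>i. d i ` C i \<subseteq> C (Suc i)"
      "\<And>i x. x \<in> C i \<Longrightarrow> d (Suc i) (d i x) = 0"
    and T: "Vector_Spaces.linear scale scale T" "\<And>i. T ` C i \<subseteq> C i"
      "\<And>i x. x \<in> C i \<Longrightarrow> d i (T x) = T (d i x)"
  shows "(\<Sum>i\<le>n. (-1) ^ i * quot_trace scale T {x \<in> C i. d i x = 0}
      (if i = 0 then {0} else d (i - 1) ` C (i - 1))) = (\<Sum>i\<le>n. (-1) ^ i * trace_on T (C i))"
proof -
  define Z where "Z i = {x \<in> C i. d i x = 0}" for i
  define B where "B i = (if i = 0 then {0} else d (i - 1) ` C (i - 1))" for i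
  have sC: "subspace (C i)" for i using C unfolding fin_dim_def by blast
  have sB: "subspace (B i)" for i
  proof -
    interpret d: Vector_Spaces.linear scale scale "d (i - 1)" by (rule d(1))
    show ?thesis unfolding B_def using d.subspace_image[OF sC] by (simp add: subspace_single_0)
  qed
  have sZ: "subspace (Z i)" for i
  proof -
    interpret d: Vector_Spaces.linear scale scale "d i" by (rule d(1))
    show ?thesis
      using sC[of i] unfolding Z_def subspace_def by (auto simp: d.add d.scale)
  qed
  have ZC: "Z i \<subseteq> C i" for i unfolding Z_def by blast
  have BZ: "B i \<subseteq> Z i" for i
  proof (cases i)
    case 0
    then show ?thesis using subspace_0[OF sZ] by (simp add: B_def)
  next
    case (Suc j)
    then show ?thesis using d(2)[of j] d(3)[of _ j] unfolding B_def Z_def by auto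
  qed
  interpret T: Vector_Spaces.linear scale scale T by (rule T(1))
  have TZ: "T ` Z i \<subseteq> Z i" for i
    using T(2)[of i] T(3)[of _ i] unfolding Z_def by auto
  have TB: "T ` B i \<subseteq> B i" for i
  proof (cases i)
    case 0
    then show ?thesis by (simp add: B_def)
  next
    case (Suc j)
    show ?thesis
    proof
      fix y assume "y \<in> T ` B i"
      then obtain x where x: "x \<in> C j" "y = T (d j x)" using Suc by (auto simp: B_def)
      then have "y = d j (T x)" "T x \<in> C j" using T(2)[of j] T(3)[of x j] by auto
      then show "y \<in> B i" using Suc by (simp add: B_def)
    qed
  qed
  have q: "quot_trace scale T (Z i) (B i) = trace_on T (Z i) - trace_on T (B i)" for i
    by (rule quot_trace_eq[OF fin_dim_subspace[OF C sZ ZC] sB BZ T(1) TZ TB])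
  have CZ: "trace_on T (C i) = trace_on T (Z i) + trace_on T (B (Suc i))" for i
    using trace_on_kernel_image[of "C i" "d i" T, OF C d(1) T(1) T(2) T(3)]
    by (simp add: Z_def B_def)
  have B0: "trace_on T (B 0) = 0" by (simp add: B_def trace_on_zero[OF T(1)])
  have "B (Suc n) = {0}"
    using BZ[of "Suc n"] ZC[of "Suc n"] top subspace_0[OF sB[of "Suc n"]] by auto
  then have Bn: "trace_on T (B (Suc n)) = 0" by (simp add: trace_on_zero[OF T(1)])
  \<comment> \<open>The identity is proved for every cut-off \<open>m\<close>, with one boundary
    term left over; at \<open>m = n\<close> that term vanishes because the next space of the complex
    is zero.\<close>
  have "(\<Sum>i\<le>m. (-1) ^ i * (trace_on T (Z i) - trace_on T (B i)))
      = (\<Sum>i\<le>m. (-1) ^ i * trace_on T (C i)) - (-1) ^ m * trace_on T (B (Suc m))" for m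
    by (induction m) (simp_all add: CZ B0 algebra_simps)
  from this[of n] show ?thesis
    by (simp add: q Bn Z_def[symmetric] B_def[symmetric])
qed

end

section \<open>Alternating maps and Koszul differentials\<close>

lemma cscale_nth [simp]: "cscale c M $ i $ j = c * M $ i $ j"
  by (simp add: cscale_def)

interpretation cscale: vector_space "cscale :: complex \<Rightarrow> complex^'a^'b \<Rightarrow> complex^'a^'b"
  by unfold_locales (simp_all add: vec_eq_iff algebra_simps)

lemma cscale_matrix_mult_left: "cscale c A ** B = cscale c (A ** B)"
  by (simp add: vec_eq_iff matrix_matrix_mult_def sum_distrib_left mult.assoc)

lemma cscale_matrix_mult_right: "A ** cscale c B = cscale c (A ** B)"
  by (simp add: vec_eq_iff matrix_matrix_mult_def sum_distrib_left mult.left_commute)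

lemma matrix_mult_add_right: "((A::complex^'n^'m) + B) ** C = A ** C + B ** C"
  by (simp add: vec_eq_iff matrix_matrix_mult_def algebra_simps sum.distrib)

lemma matrix_mult_diff_right: "((A::complex^'n^'m) - B) ** C = A ** C - B ** C"
  by (simp add: vec_eq_iff matrix_matrix_mult_def algebra_simps sum_subtractf)

lemma matrix_mult_diff_left: "(A::complex^'n^'m) ** (B - C) = A ** B - A ** C"
  by (simp add: vec_eq_iff matrix_matrix_mult_def algebra_simps sum_subtractf)

lemma matrix_mult_zero [simp]: "(A::complex^'n^'m) ** 0 = 0" "0 ** (B::complex^'n^'m) = 0"
  by (simp_all add: vec_eq_iff matrix_matrix_mult_def)

lemma matrix_mult_sum_left: "(A::complex^'n^'m) ** (\<Sum>i\<in>I. f i) = (\<Sum>i\<in>I. A ** f i)"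
  by (induction I rule: infinite_finite_induct) (simp_all add: matrix_add_ldistrib)

lemma matrix_mult_sum_right: "(\<Sum>i\<in>I. f i) ** (A::complex^'n^'m) = (\<Sum>i\<in>I. f i ** A)"
  by (induction I rule: infinite_finite_induct) (simp_all add: matrix_mult_add_right)

section \<open>Multilinear and alternating maps\<close>

text \<open>Membership in \<open>cochains\<close> minus alternation and equivariance. The separation
  matters because the monomial forms that are averaged later are only multilinear.\<close>

definition multilin :: "nat \<Rightarrow> ('n::finite,'x::finite,'y::finite) cochain \<Rightarrow> bool" where
  "multilin i psi \<longleftrightarrow>
     (\<forall>vs vs'. (\<forall>j<i. vs j = vs' j) \<longrightarrow> psi vs = psi vs') \<and>
     (\<forall>vs j a b. j < i \<longrightarrow> psi (vs(j := a + b)) = psi (vs(j := a)) + psi (vs(j := b))) \<and>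
     (\<forall>vs j c a. j < i \<longrightarrow> psi (vs(j := c *s a)) = cscale c (psi (vs(j := a))))"

definition altmap :: "nat \<Rightarrow> ('n::finite,'x::finite,'y::finite) cochain \<Rightarrow> bool" where
  "altmap i psi \<longleftrightarrow> multilin i psi \<and> (\<forall>vs j l. j < l \<and> l < i \<and> vs j = vs l \<longrightarrow> psi vs = 0)"

lemma multilin_cong: "multilin i psi \<Longrightarrow> (\<And>j. j < i \<Longrightarrow> vs j = vs' j) \<Longrightarrow> psi vs = psi vs'"
  and multilin_add: "multilin i psi \<Longrightarrow> j < i \<Longrightarrow>
    psi (vs(j := a + b)) = psi (vs(j := a)) + psi (vs(j := b))"
  and multilin_scale: "multilin i psi \<Longrightarrow> j < i \<Longrightarrow> psi (vs(j := c *s a)) = cscale c (psi (vs(j := a)))"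
  unfolding multilin_def by blast+

lemma altmap_multilin: "altmap i psi \<Longrightarrow> multilin i psi"
  unfolding altmap_def by blast

lemma altmap_zero: "altmap i psi \<Longrightarrow> j < i \<Longrightarrow> l < i \<Longrightarrow> j \<noteq> l \<Longrightarrow> vs j = vs l \<Longrightarrow> psi vs = 0"
  unfolding altmap_def by (metis nat_neq_iff)

text \<open>Polarization with the sum of both vectors in both slots. Vanishing is assumed for the
  single pair \<open>j\<close>, \<open>l\<close>, so that the lemma can be applied before the map is
  known to be alternating.\<close>

lemma multilin_swap:
  assumes m: "multilin i psi" and jl: "j < i" "l < i" "j \<noteq> l"
    and z: "\<And>vs. vs j = vs l \<Longrightarrow> psi vs = 0"
  shows "psi (vs(j := vs l, l := vs j)) = - psi vs"
proof -
  let ?a = "vs j" and ?b = "vs l"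
  have "0 = psi (vs(j := ?a + ?b, l := ?a + ?b))"
    by (rule z[symmetric]) (use jl in simp)
  also have "\<dots> = psi (vs(l := ?a + ?b, j := ?a + ?b))"
    by (simp only: fun_upd_twist[OF jl(3)])
  also have "\<dots> = psi (vs(l := ?a + ?b, j := ?a)) + psi (vs(l := ?a + ?b, j := ?b))"
    by (rule multilin_add[OF m jl(1)])
  also have "psi (vs(l := ?a + ?b, j := ?a)) = psi (vs(j := ?a, l := ?a + ?b))"
    by (simp only: fun_upd_twist[OF jl(3)])
  also have "\<dots> = psi (vs(j := ?a, l := ?a)) + psi (vs(j := ?a, l := ?b))"
    by (rule multilin_add[OF m jl(2)])
  also have "psi (vs(l := ?a + ?b, j := ?b)) = psi (vs(j := ?b, l := ?a + ?b))"
    by (simp only: fun_upd_twist[OF jl(3)])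
  also have "\<dots> = psi (vs(j := ?b, l := ?a)) + psi (vs(j := ?b, l := ?b))"
    by (rule multilin_add[OF m jl(2)])
  also have "psi (vs(j := ?a, l := ?a)) = 0" by (rule z) (use jl in simp)
  also have "psi (vs(j := ?b, l := ?b)) = 0" by (rule z) (use jl in simp)
  finally have "psi vs + psi (vs(j := ?b, l := ?a)) = 0" by (simp del: fun_upd_apply)
  then show ?thesis by (simp add: eq_neg_iff_add_eq_0 add.commute)
qed

text \<open>A swap of neighbouring slots only changes the sign, so two equal arguments can be moved
  together one slot at a time.\<close>

lemma altmap_from_adjacent:
  assumes m: "multilin i psi"
    and adj: "\<And>vs p. Suc p < i \<Longrightarrow> vs p = vs (Suc p) \<Longrightarrow> psi vs = 0"
  shows "altmap i psi"
proof -
  have "psi vs = 0" if "j < l" "l < i" "vs j = vs l" for vs j l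
    using that
  proof (induction l arbitrary: vs)
    case (Suc l)
    show ?case
    proof (cases "j = l")
      case True
      then show ?thesis using adj Suc.prems by blast
    next
      case False
      then have j: "j < l" using Suc.prems by simp
      have "psi (vs(l := vs (Suc l), Suc l := vs l)) = 0"
        using j Suc.prems by (intro Suc.IH) auto
      moreover have "psi (vs(l := vs (Suc l), Suc l := vs l)) = - psi vs"
        using Suc.prems adj by (intro multilin_swap[OF m]) auto
      ultimately show ?thesis by simp
    qed
  qed simp
  then show ?thesis using m unfolding altmap_def by blast
qed

lemma altmap_transpose:
  assumes a: "altmap i psi" and jl: "j < i" "l < i" "j \<noteq> l"
  shows "psi (vs \<circ> Transposition.transpose j l) = - psi vs"
proof -
  have "vs \<circ> Transposition.transpose j l = vs(j := vs l, l := vs j)"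
    using jl by (auto simp: Transposition.transpose_def)
  then show ?thesis
    using multilin_swap[OF altmap_multilin[OF a] jl, of vs] altmap_zero[OF a jl] by simp
qed

lemma altmap_permute:
  assumes a: "altmap i psi" and p: "p permutes {..<i}"
  shows "psi (vs \<circ> p) = cscale (of_int (sign p)) (psi vs)"
proof -
  have "\<forall>vs. psi (vs \<circ> p) = cscale (of_int (sign p)) (psi vs)"
    using finite_lessThan p
  proof (induction rule: permutes_rev_induct)
    case id
    show ?case by (simp add: sign_id)
  next
    case (swap j l p)
    then have "permutation p" by (auto intro: permutes_imp_permutation)
    then have "sign (p \<circ> Transposition.transpose j l) = - sign p"
      using swap by (simp add: sign_compose permutation_swap_id sign_swap_id)
    moreover have "psi (vs \<circ> p \<circ> Transposition.transpose j l) = - psi (vs \<circ> p)" for vs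
      using swap by (intro altmap_transpose[OF a]) auto
    ultimately show ?case using swap by (simp add: o_assoc del: o_apply)
  qed
  then show ?thesis by blast
qed

lemma multilin_slot_sum:
  assumes m: "multilin i psi" and j: "j < i"
  shows "psi (vs(j := (\<Sum>r\<in>I. c r *s e r))) = (\<Sum>r\<in>I. cscale (c r) (psi (vs(j := e r))))"
proof -
  have z: "psi (vs(j := 0)) = 0"
    using multilin_scale[OF m j, of vs 0 0] by (simp del: fun_upd_apply)
  show ?thesis
    by (induction I rule: infinite_finite_induct)
       (simp_all add: z multilin_add[OF m j] multilin_scale[OF m j] del: fun_upd_apply)
qed

lemma multilin_expand:
  assumes m: "multilin i psi"
  shows "psi vs = (\<Sum>f\<in>{..<i} \<rightarrow>\<^sub>E UNIV. cscale (\<Prod>j<i. vs j $ f j) (psi (\<lambda>j. axis (f j) 1)))"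
proof -
  \<comment> \<open>The slots are expanded one at a time: after \<open>k\<close> steps the first
    \<open>k\<close> hold coordinate vectors and the rest are untouched. Extensional functions count
    each tuple exactly once.\<close>
  have "psi vs = (\<Sum>f\<in>{..<k} \<rightarrow>\<^sub>E UNIV.
      cscale (\<Prod>j<k. vs j $ f j) (psi (\<lambda>j. if j < k then axis (f j) 1 else vs j)))" if "k \<le> i" for k
    using that
  proof (induction k)
    case 0
    show ?case by simp
  next
    case (Suc k)
    then have k: "k < i" by simp
    let ?w = "\<lambda>f j. if j < k then axis (f j) 1 else vs j"
    have vk: "vs k = (\<Sum>r\<in>UNIV. vs k $ r *s axis r 1)"
      by (simp add: basis_expansion)
    have step: "psi (?w f) = (\<Sum>r\<in>UNIV. cscale (vs k $ r) (psi ((?w f)(k := axis r 1))))" for f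
    proof -
      have "?w f = (?w f)(k := (\<Sum>r\<in>UNIV. vs k $ r *s axis r 1))"
        using vk by auto
      then show ?thesis using multilin_slot_sum[OF m k, of "?w f" "\<lambda>r. vs k $ r" "\<lambda>r. axis r 1" UNIV] by metis
    qed
    have "psi vs = (\<Sum>f\<in>{..<k} \<rightarrow>\<^sub>E UNIV. cscale (\<Prod>j<k. vs j $ f j) (psi (?w f)))"
      using Suc by simp
    also have "\<dots> = (\<Sum>f\<in>{..<k} \<rightarrow>\<^sub>E UNIV. \<Sum>r\<in>UNIV.
        cscale ((\<Prod>j<k. vs j $ f j) * vs k $ r) (psi ((?w f)(k := axis r 1))))"
      by (subst step) (simp add: cscale.scale_sum_right)
    also have "\<dots> = (\<Sum>(r, f)\<in>UNIV \<times> ({..<k} \<rightarrow>\<^sub>E UNIV).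
        cscale ((\<Prod>j<k. vs j $ f j) * vs k $ r) (psi ((?w f)(k := axis r 1))))"
      by (subst sum.swap) (simp add: sum.cartesian_product)
    also have "\<dots> = (\<Sum>f\<in>{..<Suc k} \<rightarrow>\<^sub>E UNIV. cscale (\<Prod>j<Suc k. vs j $ f j)
        (psi (\<lambda>j. if j < Suc k then axis (f j) 1 else vs j)))"
    proof (rule sum.reindex_bij_witness[of _ "\<lambda>f. (f k, restrict f {..<k})" "\<lambda>(r, f). f(k := r)"])
      fix p :: "'a \<times> (nat \<Rightarrow> 'a)" assume "p \<in> UNIV \<times> ({..<k} \<rightarrow>\<^sub>E UNIV)"
      then obtain r f where p: "p = (r, f)" and f: "f \<in> extensional {..<k}" by (auto simp: PiE_def)
      show "((case p of (r, f) \<Rightarrow> f(k := r)) k, restrict (case p of (r, f) \<Rightarrow> f(k := r)) {..<k}) = p"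
        using f by (auto simp: p extensional_def restrict_def fun_eq_iff)
      show "(case p of (r, f) \<Rightarrow> f(k := r)) \<in> {..<Suc k} \<rightarrow>\<^sub>E UNIV"
        using f by (auto simp: p extensional_def PiE_def)
      have "(\<lambda>j. if j < Suc k then axis ((f(k := r)) j) 1 else vs j) = (?w f)(k := axis r 1)"
        by (auto simp: fun_eq_iff)
      then show "cscale (\<Prod>j<Suc k. vs j $ (case p of (r, f) \<Rightarrow> f(k := r)) j)
          (psi (\<lambda>j. if j < Suc k then axis ((case p of (r, f) \<Rightarrow> f(k := r)) j) 1 else vs j)) =
        (case p of (r, f) \<Rightarrow> cscale ((\<Prod>j<k. vs j $ f j) * vs k $ r) (psi ((?w f)(k := axis r 1))))"
        unfolding p prod.case by simp
    next
      fix f :: "nat \<Rightarrow> 'a" assume "f \<in> {..<Suc k} \<rightarrow>\<^sub>E UNIV"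
      then have f: "f \<in> extensional {..<Suc k}" by (auto simp: PiE_def)
      show "(case (f k, restrict f {..<k}) of (r, f) \<Rightarrow> f(k := r)) = f"
        using f by (auto simp: extensional_def restrict_def fun_eq_iff)
      show "(f k, restrict f {..<k}) \<in> UNIV \<times> ({..<k} \<rightarrow>\<^sub>E UNIV)" by auto
    qed
    finally show ?case .
  qed
  from this[of i] have "psi vs = (\<Sum>f\<in>{..<i} \<rightarrow>\<^sub>E UNIV.
      cscale (\<Prod>j<i. vs j $ f j) (psi (\<lambda>j. if j < i then axis (f j) 1 else vs j)))" by simp
  also have "\<dots> = (\<Sum>f\<in>{..<i} \<rightarrow>\<^sub>E UNIV. cscale (\<Prod>j<i. vs j $ f j) (psi (\<lambda>j. axis (f j) 1)))"
    by (intro sum.cong refl arg_cong2[where f = cscale] multilin_cong[OF m]) auto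
  finally show ?thesis .
qed

text \<open>By pigeonhole, more than n coordinate vectors contain a repetition.\<close>

lemma altmap_vanish:
  fixes psi :: "('n::finite,'x::finite,'y::finite) cochain"
  assumes a: "altmap i psi" and i: "i > CARD('n)"
  shows "psi = 0"
proof
  fix vs
  have "psi (\<lambda>j. axis (f j) 1) = 0" for f :: "nat \<Rightarrow> 'n"
  proof -
    have "\<not> inj_on f {..<i}"
    proof
      assume "inj_on f {..<i}"
      then have "card {..<i} \<le> CARD('n)" by (rule card_inj_on_le) auto
      then show False using i by simp
    qed
    then obtain j l where "j < i" "l < i" "j \<noteq> l" "f j = f l" unfolding inj_on_def by auto
    then show ?thesis using altmap_zero[OF a, of j l "\<lambda>j. axis (f j) 1"] by simp
  qed
  then show "psi vs = 0 vs"
    by (subst multilin_expand[OF altmap_multilin[OF a]]) simp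
qed

section \<open>Koszul differentials\<close>

text \<open>The operation \<open>D\<close> is left open to cover both the differential of the
  complex and the wedge product with a linear form.\<close>

definition koszul :: "(complex^'n::finite \<Rightarrow> complex^'x::finite^'y::finite \<Rightarrow> complex^'x^'y) \<Rightarrow> nat
    \<Rightarrow> ('n,'x,'y) cochain \<Rightarrow> ('n,'x,'y) cochain" where
  "koszul D i psi = (\<lambda>vs. \<Sum>j<Suc i. cscale ((-1) ^ (j + 1)) (D (vs j) (psi (omit j vs))))"

definition bilin :: "(complex^'n::finite \<Rightarrow> complex^'x::finite^'y::finite \<Rightarrow> complex^'x^'y) \<Rightarrow> bool" where
  "bilin D \<longleftrightarrow> (\<forall>u v M. D (u + v) M = D u M + D v M) \<and> (\<forall>c v M. D (c *s v) M = cscale c (D v M)) \<and>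
     (\<forall>v M N. D v (M + N) = D v M + D v N) \<and> (\<forall>c v M. D v (cscale c M) = cscale c (D v M))"

lemma bilinD:
  assumes "bilin D"
  shows "D (u + v) M = D u M + D v M" "D (c *s v) M = cscale c (D v M)"
    "D v (M + N) = D v M + D v N" "D v (cscale c M) = cscale c (D v M)"
  using assms unfolding bilin_def by blast+

lemma bilin_zero: "bilin D \<Longrightarrow> D v 0 = 0"
  using bilinD(4)[of D v 0 0] by simp

lemma bilin_uminus: "bilin D \<Longrightarrow> D v (- M) = - D v M"
  using bilinD(4)[of D v "-1" M] by simp

lemma bilin_sum: "bilin D \<Longrightarrow> D v (\<Sum>i\<in>I. f i) = (\<Sum>i\<in>I. D v (f i))"
  by (induction I rule: infinite_finite_induct) (simp_all add: bilinD bilin_zero)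

lemma omit_upd:
  "l < j \<Longrightarrow> omit j (vs(l := a)) = (omit j vs)(l := a)"
  "omit j (vs(j := a)) = omit j vs"
  "j < l \<Longrightarrow> omit j (vs(l := a)) = (omit j vs)(l - 1 := a)"
  by (auto simp: omit_def fun_eq_iff)

lemma multilin_koszul:
  assumes D: "bilin D" and m: "multilin i psi"
  shows "multilin (Suc i) (koszul D i psi)"
  unfolding multilin_def
proof (intro conjI allI impI)
  fix vs vs' :: "nat \<Rightarrow> complex^'a" assume eq: "\<forall>j<Suc i. vs j = vs' j"
  show "koszul D i psi vs = koszul D i psi vs'"
    unfolding koszul_def
  proof (intro sum.cong refl)
    fix j assume "j \<in> {..<Suc i}"
    then have "psi (omit j vs) = psi (omit j vs')" "vs j = vs' j"
      using eq by (auto intro!: multilin_cong[OF m] simp: omit_def)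
    then show "cscale ((-1) ^ (j + 1)) (D (vs j) (psi (omit j vs))) =
        cscale ((-1) ^ (j + 1)) (D (vs' j) (psi (omit j vs')))" by simp
  qed
next
  fix vs :: "nat \<Rightarrow> complex^'a" and l a b assume l: "l < Suc i"
  have "D ((vs(l := a + b)) j) (psi (omit j (vs(l := a + b)))) =
      D ((vs(l := a)) j) (psi (omit j (vs(l := a)))) + D ((vs(l := b)) j) (psi (omit j (vs(l := b))))"
    if "j < Suc i" for j
    using l that multilin_add[OF m, of l "omit j vs" a b] multilin_add[OF m, of "l - 1" "omit j vs" a b]
    by (cases l j rule: linorder_cases) (auto simp: omit_upd bilinD[OF D])
  then show "koszul D i psi (vs(l := a + b)) = koszul D i psi (vs(l := a)) + koszul D i psi (vs(l := b))"
    unfolding koszul_def by (simp only: sum.distrib[symmetric] cscale.scale_right_distrib[symmetric])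
      (intro sum.cong refl, simp)
next
  fix vs :: "nat \<Rightarrow> complex^'a" and l c a assume l: "l < Suc i"
  have "D ((vs(l := c *s a)) j) (psi (omit j (vs(l := c *s a)))) =
      cscale c (D ((vs(l := a)) j) (psi (omit j (vs(l := a)))))"
    if "j < Suc i" for j
    using l that multilin_scale[OF m, of l "omit j vs" c a] multilin_scale[OF m, of "l - 1" "omit j vs" c a]
    by (cases l j rule: linorder_cases) (auto simp: omit_upd bilinD[OF D])
  then show "koszul D i psi (vs(l := c *s a)) = cscale c (koszul D i psi (vs(l := a)))"
    unfolding koszul_def cscale.scale_sum_right
    by (intro sum.cong refl) (simp add: cscale.scale_left_commute)
qed

text \<open>When the arguments at \<open>p\<close> and \<open>Suc p\<close> coincide, omitting any
  other slot leaves both in place and gives zero. Omitting either of the two gives the same value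
  with opposite signs.\<close>

lemma altmap_koszul:
  assumes D: "bilin D" and a: "altmap i psi"
  shows "altmap (Suc i) (koszul D i psi)"
proof (rule altmap_from_adjacent[OF multilin_koszul[OF D altmap_multilin[OF a]]])
  fix vs :: "nat \<Rightarrow> complex^'a" and p assume p: "Suc p < Suc i" and eq: "vs p = vs (Suc p)"
  let ?t = "\<lambda>j. cscale ((-1) ^ (j + 1)) (D (vs j) (psi (omit j vs)))"
  have z: "?t j = 0" if "j < Suc i" "j \<noteq> p" "j \<noteq> Suc p" for j
  proof -
    have "psi (omit j vs) = 0"
    proof (cases "j < p")
      case True
      then show ?thesis using eq p by (intro altmap_zero[OF a, of "p - 1" p]) (auto simp: omit_def)
    next
      case False
      then show ?thesis using eq p that by (intro altmap_zero[OF a, of p "Suc p"]) (auto simp: omit_def)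
    qed
    then show ?thesis by (simp add: bilin_zero[OF D])
  qed
  have "omit p vs = omit (Suc p) vs"
    using eq by (auto simp: omit_def fun_eq_iff less_Suc_eq)
  then have c: "?t p + ?t (Suc p) = 0"
    using eq by (simp add: cscale.scale_left_distrib[symmetric])
  have "koszul D i psi vs = sum ?t {p, Suc p}"
    unfolding koszul_def by (rule sum.mono_neutral_right) (use p z in auto)
  then show "koszul D i psi vs = 0" using c by simp
qed

lemma omit_omit: "j \<le> l \<Longrightarrow> omit l (omit j vs) = omit j (omit (Suc l) vs)"
  by (auto simp: omit_def fun_eq_iff)

text \<open>The same two arguments are removed in either order, once as (j, l) with j at most l and
  once as (Suc l, j). The index shift flips the sign, and commutation of the two operations makes
  the terms cancel.\<close>

lemma koszul_koszul:
  assumes D: "bilin D" and comm: "\<And>u v M. D u (D v M) = D v (D u M)"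
  shows "koszul D (Suc i) (koszul D i psi) = 0"
proof
  fix vs
  define t where "t j l = cscale ((-1) ^ (j + l)) (D (vs j) (D (omit j vs l) (psi (omit l (omit j vs)))))" for j l
  let ?P = "{..<Suc (Suc i)} \<times> {..<Suc i}"
  have tt: "t (Suc l) j = - t j l" if "j \<le> l" for j l
    using that
    by (simp add: t_def omit_omit comm[of "vs j"]) (simp add: omit_def add.commute)
  have "koszul D (Suc i) (koszul D i psi) vs = (\<Sum>(j, l)\<in>?P. t j l)"
    unfolding koszul_def t_def bilin_sum[OF D] cscale.scale_sum_right sum.cartesian_product[symmetric]
    by (intro sum.cong refl) (simp add: bilinD[OF D] bilin_uminus[OF D] power_add)
  also have "\<dots> = (\<Sum>(j, l)\<in>{(j, l) \<in> ?P. j \<le> l}. t j l) + (\<Sum>(j, l)\<in>{(j, l) \<in> ?P. l < j}. t j l)"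
    by (subst sum.union_disjoint[symmetric]) (auto intro!: sum.cong intro: finite_subset[of _ ?P])
  also have "(\<Sum>(j, l)\<in>{(j, l) \<in> ?P. l < j}. t j l) = (\<Sum>(j, l)\<in>{(j, l) \<in> ?P. j \<le> l}. - t j l)"
    by (rule sum.reindex_bij_witness[of _ "\<lambda>(j, l). (Suc l, j)" "\<lambda>(j, l). (l, j - 1)"])
       (auto simp: tt[symmetric])
  also have "\<dots> = - (\<Sum>(j, l)\<in>{(j, l) \<in> ?P. j \<le> l}. t j l)"
    by (simp add: sum_negf[symmetric] case_prod_beta)
  finally show "koszul D (Suc i) (koszul D i psi) vs = 0 vs" by simp
qed

text \<open>For a linear form \<open>L\<close>, the form \<open>L \<and> \<psi>\<close> restricted to the kernel of \<open>L\<close> vanishes and an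
  alternating form sees at most one copy of \<open>a\<close>; so the reflection in \<open>a\<close> along the kernel of \<open>L\<close>
  acts on \<open>L \<and> \<psi>\<close> by \<open>- 1\<close>.\<close>

lemma koszul_reflection:
  fixes L :: "complex^'n::finite \<Rightarrow> complex" and psi :: "('n,'x::finite,'y::finite) cochain"
  assumes L: "\<And>u v. L (u + v) = L u + L v" "\<And>c v. L (c *s v) = c * L v" and La: "L a = 2"
    and psi: "altmap i psi"
  defines "s \<equiv> \<lambda>v. v - L v *s a"
  defines "G \<equiv> koszul (\<lambda>v. cscale (L v)) i psi"
  shows "G (\<lambda>j. s (vs j)) = - G vs"
proof -
  have "bilin (\<lambda>v. cscale (L v) :: complex^'x^'y \<Rightarrow> _)"
    unfolding bilin_def by (simp add: L cscale.scale_left_distrib cscale.scale_right_distrib mult.commute)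
  then have G: "altmap (Suc i) G" unfolding G_def using psi by (rule altmap_koszul)
  then have mG: "multilin (Suc i) G" by (rule altmap_multilin)
  have s_add: "s (u + v) = s u + s v" for u v by (simp add: s_def L vec_eq_iff algebra_simps)
  have s_scale: "s (c *s v) = c *s s v" for c v
    by (simp add: s_def L vec_eq_iff algebra_simps)
  have sa: "s a = (-1) *s a" by (simp add: s_def La vec_eq_iff)
  have s_ker: "s v = v" if "L v = 0" for v using that by (simp add: s_def)
  \<comment> \<open>Induction on the number of slots not yet normalised: from slot \<open>k\<close>
    on, every vector lies in the kernel of \<open>L\<close> or equals \<open>a\<close>. The step
    splits the vector in slot \<open>k\<close> accordingly.\<close>
  have "G (\<lambda>j. s (vs j)) = - G vs" if "\<And>j. k \<le> j \<Longrightarrow> j < Suc i \<Longrightarrow> L (vs j) = 0 \<or> vs j = a"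
      "k \<le> Suc i" for k vs
    using that
  proof (induction k arbitrary: vs)
    case 0
    then have vs: "L (vs j) = 0 \<or> vs j = a" if "j < Suc i" for j using that by simp
    show ?case
    proof (cases "\<exists>l<Suc i. vs l = a")
      case False
      then have "G vs = 0" "G (\<lambda>j. s (vs j)) = 0"
        using vs unfolding G_def koszul_def by (auto intro!: sum.neutral simp: s_ker)
      then show ?thesis by simp
    next
      case True
      then obtain l where l: "l < Suc i" "vs l = a" by blast
      show ?thesis
      proof (cases "\<exists>m<Suc i. m \<noteq> l \<and> vs m = a")
        case True
        then obtain m where m: "m < Suc i" "m \<noteq> l" "vs m = a" by blast
        have "G vs = 0" by (rule altmap_zero[OF G m(1) l(1) m(2)]) (simp add: m l)
        moreover have "G (\<lambda>j. s (vs j)) = 0"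
          by (rule altmap_zero[OF G m(1) l(1) m(2)]) (simp add: m l)
        ultimately show ?thesis by simp
      next
        case False
        have "G (\<lambda>j. s (vs j)) = G (vs(l := (-1) *s a))"
        proof (rule multilin_cong[OF mG])
          fix j assume j: "j < Suc i"
          show "s (vs j) = (vs(l := (-1) *s a)) j"
          proof (cases "j = l")
            case True
            then show ?thesis by (simp add: l sa)
          next
            case jl: False
            then have "vs j \<noteq> a" using False j by blast
            then have "L (vs j) = 0" using vs[OF j] by blast
            then show ?thesis using jl by (simp add: s_ker)
          qed
        qed
        also have "\<dots> = cscale (-1) (G (vs(l := a)))" by (rule multilin_scale[OF mG l(1)])
        also have "vs(l := a) = vs" using l by auto
        finally show ?thesis by simp
      qed
    qed
  next
    case (Suc k)
    then have k: "k < Suc i" by simp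
    \<comment> \<open>The factor 1/2 puts \<open>u\<close> into the kernel, as
      \<open>L a = 2\<close>.\<close>
    define c where "c = L (vs k) / 2"
    define u where "u = vs k - c *s a"
    have "L (vs k) = L (u + c *s a)" unfolding u_def by simp
    then have "L u = 0" by (simp add: L La c_def)
    have vk: "vs k = u + c *s a" unfolding u_def by simp
    have 1: "G vs = G (vs(k := u)) + cscale c (G (vs(k := a)))"
      using multilin_add[OF mG k, of vs u "c *s a"] multilin_scale[OF mG k, of vs c a] vk
      by (metis fun_upd_triv)
    have upd: "(\<lambda>j. s ((vs(k := x)) j)) = (\<lambda>j. s (vs j))(k := s x)" for x by auto
    have "(\<lambda>j. s (vs j)) = (\<lambda>j. s (vs j))(k := s u + c *s s a)"
      by (auto simp: fun_eq_iff vk s_add s_scale)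
    then have 2: "G (\<lambda>j. s (vs j)) = G ((\<lambda>j. s (vs j))(k := s u)) + cscale c (G ((\<lambda>j. s (vs j))(k := s a)))"
      using multilin_add[OF mG k, of "\<lambda>j. s (vs j)" "s u" "c *s s a"]
        multilin_scale[OF mG k, of "\<lambda>j. s (vs j)" c "s a"] by metis
    have "G (\<lambda>j. s ((vs(k := u)) j)) = - G (vs(k := u))"
      using Suc.prems \<open>L u = 0\<close> by (intro Suc.IH) (auto simp: le_Suc_eq)
    moreover have "G (\<lambda>j. s ((vs(k := a)) j)) = - G (vs(k := a))"
      using Suc.prems by (intro Suc.IH) (auto simp: le_Suc_eq)
    ultimately show ?case using 1 2 unfolding upd by simp
  qed
  from this[of "Suc i"] show ?thesis by simp
qed

text \<open>The reflection negates L, so substituting it into L wedge psi gives minus L wedge (psi o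
  s); by \<open>koszul_reflection\<close> it also gives minus L wedge psi. This equality cancels the
  k-dependent corrections in the differential.\<close>

lemma koszul_reflection_invariant:
  fixes L :: "complex^'n::finite \<Rightarrow> complex" and psi :: "('n,'x::finite,'y::finite) cochain"
  assumes L: "\<And>u v. L (u + v) = L u + L v" "\<And>c v. L (c *s v) = c * L v" and La: "L a = 2"
    and psi: "altmap i psi"
  shows "(\<Sum>j<Suc i. cscale ((-1) ^ (j + 1)) (cscale (L (vs j)) (psi (\<lambda>l. omit j vs l - L (omit j vs l) *s a))))
    = (\<Sum>j<Suc i. cscale ((-1) ^ (j + 1)) (cscale (L (vs j)) (psi (omit j vs))))"
proof -
  have neg: "L (v - L v *s a) = - L v" for v
  proof -
    have "L (v - L v *s a) + L (L v *s a) = L v" unfolding L(1)[symmetric] by simp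
    then show ?thesis by (simp add: L La eq_neg_iff_add_eq_0 add.commute)
  qed
  have om: "omit j (\<lambda>j. vs j - L (vs j) *s a) = (\<lambda>l. omit j vs l - L (omit j vs l) *s a)" for j
    by (auto simp: omit_def)
  show ?thesis
    using koszul_reflection[OF L La psi, of vs]
    by (simp add: koszul_def neg om sum_negf del: sum.lessThan_Suc)
qed

section \<open>Principal minors and traces of matrices of finite order\<close>

lemma sum_permutes_antisymmetric:
  fixes h :: "('a \<Rightarrow> 'a) \<Rightarrow> 'b::real_vector"
  assumes jl: "j \<in> S" "l \<in> S"
    and h: "\<And>p. p permutes S \<Longrightarrow> h (Transposition.transpose j l \<circ> p) = - h p"
  shows "(\<Sum>p | p permutes S. h p) = 0"
proof -
  let ?t = "\<lambda>p. Transposition.transpose j l \<circ> p"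
  have tp: "?t p permutes S" if "p permutes S" for p
    using that jl by (intro permutes_compose permutes_swap_id)
  have tt: "?t (?t p) = p" for p by (simp add: o_assoc)
  have "(\<Sum>p | p permutes S. h p) = (\<Sum>p | p permutes S. h (?t p))"
    by (rule sum.reindex_bij_witness[of _ ?t ?t]) (auto simp: tp tt simp del: o_apply)
  also have "\<dots> = - (\<Sum>p | p permutes S. h p)"
    by (simp add: h sum_negf)
  finally have "2 *\<^sub>R (\<Sum>p | p permutes S. h p) = 0"
    unfolding scaleR_2 by (simp add: eq_neg_iff_add_eq_0)
  then show ?thesis by simp
qed

text \<open>Permutations of \<open>S\<close> are taken inside the full index type, which avoids a
  matrix type depending on \<open>S\<close>.\<close>

definition principal_minor :: "complex^'n^'n \<Rightarrow> 'n set \<Rightarrow> complex" where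
  "principal_minor A S = (\<Sum>p | p permutes S. of_int (sign p) * (\<Prod>i\<in>S. A $ i $ p i))"

text \<open>Multiplying out each Leibniz product, \<open>S\<close> records the rows from which -A is
  taken. The identity contributes on the other rows only if \<open>p\<close> fixes them, that is, if
  \<open>p\<close> permutes \<open>S\<close>.\<close>

lemma det_one_minus:
  fixes A :: "complex^'n^'n"
  shows "det (mat 1 - A) = (\<Sum>S\<in>UNIV. (-1) ^ card S * principal_minor A S)"
proof -
  let ?U = "UNIV :: 'n set"
  have entry: "(\<Prod>i\<in>?U. (mat 1 - A) $ i $ p i)
      = (\<Sum>S\<in>UNIV. if p permutes S then (-1) ^ card S * (\<Prod>i\<in>S. A $ i $ p i) else 0)"
    if p: "p permutes ?U" for p
  proof -
    have "(\<Prod>i\<in>?U. (mat 1 - A) $ i $ p i) = (\<Prod>i\<in>?U. - A $ i $ p i + (if p i = i then 1 else 0))"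
      by (intro prod.cong refl) (auto simp: mat_def)
    also have "\<dots> = (\<Sum>S\<in>Pow ?U. (\<Prod>i\<in>S. - A $ i $ p i) * (\<Prod>i\<in>?U - S. if p i = i then 1 else 0))"
      by (rule prod_add) simp
    also have "\<dots> = (\<Sum>S\<in>UNIV. if p permutes S then (-1) ^ card S * (\<Prod>i\<in>S. A $ i $ p i) else 0)"
    proof (intro sum.cong)
      fix S :: "'n set"
      have "p permutes S \<longleftrightarrow> (\<forall>i\<in>?U - S. p i = i)"
        using p unfolding permutes_def by auto
      moreover have "(\<Prod>i\<in>?U - S. if p i = i then 1 else (0::complex))
          = (if \<forall>i\<in>?U - S. p i = i then 1 else 0)"
        by (auto intro: prod.neutral)
      ultimately show "(\<Prod>i\<in>S. - A $ i $ p i) * (\<Prod>i\<in>?U - S. if p i = i then 1 else 0)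
          = (if p permutes S then (-1) ^ card S * (\<Prod>i\<in>S. A $ i $ p i) else 0)"
        by (simp add: prod_uminus)
    qed simp
    finally show ?thesis .
  qed
  have "det (mat 1 - A) = (\<Sum>p | p permutes ?U. \<Sum>S\<in>UNIV.
      if p permutes S then (-1) ^ card S * (of_int (sign p) * (\<Prod>i\<in>S. A $ i $ p i)) else 0)"
    unfolding det_def
  proof (intro sum.cong refl)
    fix p assume "p \<in> {p. p permutes ?U}"
    then have p: "p permutes ?U" by simp
    show "of_int (sign p) * (\<Prod>i\<in>?U. (mat 1 - A) $ i $ p i) = (\<Sum>S\<in>UNIV.
        if p permutes S then (-1) ^ card S * (of_int (sign p) * (\<Prod>i\<in>S. A $ i $ p i)) else 0)"
      unfolding entry[OF p] sum_distrib_left by (intro sum.cong refl) simp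
  qed
  also have "\<dots> = (\<Sum>S\<in>UNIV. \<Sum>p | p permutes ?U.
      if p permutes S then (-1) ^ card S * (of_int (sign p) * (\<Prod>i\<in>S. A $ i $ p i)) else 0)"
    by (rule sum.swap)
  also have "\<dots> = (\<Sum>S\<in>UNIV. \<Sum>p | p permutes S. (-1) ^ card S * (of_int (sign p) * (\<Prod>i\<in>S. A $ i $ p i)))"
  proof (rule sum.cong[OF refl])
    fix S :: "'n set"
    have "{p. p permutes S} = {p \<in> {p. p permutes ?U}. p permutes S}"
      using permutes_subset[of _ S ?U] by auto
    then show "(\<Sum>p | p permutes ?U. if p permutes S
        then (-1) ^ card S * (of_int (sign p) * (\<Prod>i\<in>S. A $ i $ p i)) else 0) =
      (\<Sum>p | p permutes S. (-1) ^ card S * (of_int (sign p) * (\<Prod>i\<in>S. A $ i $ p i)))"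
      by (simp only: sum.inter_filter finite_permutations finite)
  qed
  finally show ?thesis by (simp add: principal_minor_def sum_distrib_left)
qed

lemma card_bijections:
  assumes S: "card S = i" "finite S"
  shows "card {f \<in> {..<i} \<rightarrow>\<^sub>E UNIV. inj_on f {..<i} \<and> f ` {..<i} = S} = fact i"
proof -
  obtain g where g: "bij_betw g {..<i} S"
    using S ex_bij_betw_nat_finite[of S] by (auto simp: atLeast0LessThan)
  then have ginj: "inj_on g {..<i}" and gim: "g ` {..<i} = S"
    by (auto simp: bij_betw_def)
  let ?F = "{f \<in> {..<i} \<rightarrow>\<^sub>E UNIV. inj_on f {..<i} \<and> f ` {..<i} = S}"
  have "bij_betw (\<lambda>p. restrict (g \<circ> p) {..<i}) {p. p permutes {..<i}} ?F"
  proof (rule bij_betwI')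
    fix p q assume p: "p \<in> {p. p permutes {..<i}}" and q: "q \<in> {p. p permutes {..<i}}"
    show "(restrict (g \<circ> p) {..<i} = restrict (g \<circ> q) {..<i}) = (p = q)"
    proof
      assume eq: "restrict (g \<circ> p) {..<i} = restrict (g \<circ> q) {..<i}"
      show "p = q"
      proof
        fix j
        show "p j = q j"
        proof (cases "j < i")
          case True
          then have "g (p j) = g (q j)" using fun_cong[OF eq, of j] by simp
          moreover have "p j \<in> {..<i}" "q j \<in> {..<i}"
            using True p q permutes_in_image[of _ "{..<i}" j] by auto
          ultimately show ?thesis using ginj by (auto dest: inj_onD)
        next
          case False
          then show ?thesis using p q by (auto simp: permutes_def)
        qed
      qed
    qed simp
  next
    fix p assume "p \<in> {p. p permutes {..<i}}"
    then have p: "p permutes {..<i}" by simp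
    have "inj_on (g \<circ> p) {..<i}"
      using ginj permutes_image[OF p] permutes_inj_on[OF p] by (intro comp_inj_on) auto
    moreover have "(g \<circ> p) ` {..<i} = S"
      using gim permutes_image[OF p] unfolding image_comp[symmetric] by simp
    ultimately show "restrict (g \<circ> p) {..<i} \<in> ?F"
      by (simp add: inj_on_restrict_eq)
  next
    fix f assume f: "f \<in> ?F"
    define p where "p j = (if j < i then inv_into {..<i} g (f j) else j)" for j
    have "bij_betw (inv_into {..<i} g) S {..<i}" using g by (rule bij_betw_inv_into)
    moreover have "bij_betw f {..<i} S" using f by (simp add: bij_betw_def)
    ultimately have "bij_betw (inv_into {..<i} g \<circ> f) {..<i} {..<i}"
      by (rule bij_betw_trans[rotated])
    then have "bij_betw p {..<i} {..<i}"
      by (rule iffD1[OF bij_betw_cong, rotated]) (simp add: p_def)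
    then have "p permutes {..<i}" by (rule bij_imp_permutes) (simp add: p_def)
    moreover have "f = restrict (g \<circ> p) {..<i}"
    proof
      fix j
      show "f j = restrict (g \<circ> p) {..<i} j"
      proof (cases "j < i")
        case True
        then have "f j \<in> g ` {..<i}" using f gim by auto
        then show ?thesis using True by (simp add: p_def f_inv_into_f)
      next
        case False
        then show ?thesis using f by (auto simp: PiE_def extensional_def)
      qed
    qed
    ultimately show "\<exists>p\<in>{p. p permutes {..<i}}. f = restrict (g \<circ> p) {..<i}" by blast
  qed
  then have "card ?F = card {p. p permutes {..<i}}" by (simp add: bij_betw_same_card)
  also have "\<dots> = fact i" by (rule card_permutations) auto
  finally show ?thesis .
qed

text \<open>Both sides are i! times the trace of A on the i-th exterior power. Tuples with a
  repetition contribute zero by antisymmetry, an injective tuple contributes the principal minor of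
  its image, and each set of size i is the image of i! tuples.\<close>

lemma sum_tuples_principal_minor:
  fixes A :: "complex^'n^'n"
  shows "(\<Sum>f\<in>{..<i} \<rightarrow>\<^sub>E UNIV. \<Sum>p | p permutes {..<i}. of_int (sign p) * (\<Prod>j<i. A $ f j $ f (p j)))
    = fact i * (\<Sum>S | card S = i. principal_minor A S)"
proof -
  let ?m = "\<lambda>f. \<Sum>p | p permutes {..<i}. of_int (sign p) * (\<Prod>j<i. A $ f j $ f (p j))"
  let ?E = "{..<i} \<rightarrow>\<^sub>E (UNIV :: 'n set)"
  let ?I = "{f \<in> ?E. inj_on f {..<i}}"
  have finE: "finite ?E" by (simp add: finite_PiE)
  have noninj: "?m f = 0" if "\<not> inj_on f {..<i}" for f
  proof -
    obtain j l where jl: "j < i" "l < i" "j \<noteq> l" "f j = f l"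
      using \<open>\<not> inj_on f {..<i}\<close> unfolding inj_on_def by auto
    have t: "f (Transposition.transpose j l x) = f x" for x
      using jl by (simp add: Transposition.transpose_def)
    show ?thesis
    proof (rule sum_permutes_antisymmetric[of j _ l])
      fix p assume p: "p permutes {..<i}"
      then have "permutation p" by (auto intro: permutes_imp_permutation)
      then have "sign (Transposition.transpose j l \<circ> p) = - sign p"
        using jl by (simp add: sign_compose permutation_swap_id sign_swap_id)
      then show "of_int (sign (Transposition.transpose j l \<circ> p)) *
          (\<Prod>j'<i. A $ f j' $ f ((Transposition.transpose j l \<circ> p) j')) =
          - (of_int (sign p) * (\<Prod>j'<i. A $ f j' $ f (p j')))"
        by (simp add: t)
    qed (use jl in auto)
  qed
  have inj: "?m f = principal_minor A (f ` {..<i})" if f: "inj_on f {..<i}" for f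
  proof -
    let ?S = "f ` {..<i}" and ?g = "inv_into {..<i} f"
    have bf: "bij_betw f {..<i} ?S" using f by (simp add: bij_betw_def)
    then have bg: "bij_betw ?g ?S {..<i}" by (rule bij_betw_inv_into)
    show ?thesis
      unfolding principal_minor_def
    \<comment> \<open>Transport along \<open>f\<close> turns permutations of slots into permutations
      of coordinates and preserves the sign.\<close>
    proof (rule sum.reindex_bij_witness[of _ "map_permutation ?S ?g" "map_permutation {..<i} f"])
      fix p assume "p \<in> {p. p permutes {..<i}}"
      then have p: "p permutes {..<i}" by simp
      show "map_permutation ?S ?g (map_permutation {..<i} f p) = p"
        by (rule map_permutation_compose_inv[OF bf p]) (simp add: f)
      show "map_permutation {..<i} f p \<in> {p. p permutes ?S}"
        using map_permutation_permutes[OF bf p] by simp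
      have "(\<Prod>s\<in>?S. A $ s $ map_permutation {..<i} f p s) = (\<Prod>j<i. A $ f j $ f (p j))"
        by (subst prod.reindex[OF f]) (simp add: map_permutation_apply[OF f])
      then show "of_int (sign (map_permutation {..<i} f p)) *
          (\<Prod>s\<in>?S. A $ s $ map_permutation {..<i} f p s) = of_int (sign p) * (\<Prod>j<i. A $ f j $ f (p j))"
        using sign_map_permutation[OF f p] by simp
    next
      fix q assume "q \<in> {p. p permutes ?S}"
      then have q: "q permutes ?S" by simp
      show "map_permutation {..<i} f (map_permutation ?S ?g q) = q"
        by (rule map_permutation_compose_inv[OF bg q]) (simp add: f_inv_into_f)
      show "map_permutation ?S ?g q \<in> {p. p permutes {..<i}}"
        using map_permutation_permutes[OF bg q] by simp
    qed
  qed
  have "(\<Sum>f\<in>?E. ?m f) = (\<Sum>f\<in>?I. ?m f)"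
    by (rule sum.mono_neutral_right) (use finE noninj in auto)
  also have "\<dots> = (\<Sum>f\<in>?I. principal_minor A (f ` {..<i}))"
    by (rule sum.cong[OF refl], rule inj) simp
  also have "\<dots> = (\<Sum>S | card S = i. \<Sum>f\<in>{f \<in> ?I. f ` {..<i} = S}. principal_minor A (f ` {..<i}))"
  proof (rule sum.group[symmetric])
    show "finite ?I" using finE by simp
    show "finite {S :: 'n set. card S = i}" by simp
    show "(\<lambda>f. f ` {..<i}) ` ?I \<subseteq> {S. card S = i}"
    proof
      fix S assume "S \<in> (\<lambda>f. f ` {..<i}) ` ?I"
      then obtain f where "inj_on f {..<i}" "S = f ` {..<i}" by blast
      then show "S \<in> {S. card S = i}" by (simp add: card_image)
    qed
  qed
  also have "\<dots> = (\<Sum>S | card S = i. fact i * principal_minor A S)"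
  proof (rule sum.cong[OF refl])
    fix S :: "'n set" assume "S \<in> {S. card S = i}"
    then have "card {f \<in> ?E. inj_on f {..<i} \<and> f ` {..<i} = S} = fact i"
      by (intro card_bijections) auto
    moreover have "{f \<in> ?I. f ` {..<i} = S} = {f \<in> ?E. inj_on f {..<i} \<and> f ` {..<i} = S}" by auto
    ultimately show "(\<Sum>f\<in>{f \<in> ?I. f ` {..<i} = S}. principal_minor A (f ` {..<i})) = fact i * principal_minor A S"
      by simp
  qed
  finally show ?thesis by (simp add: sum_distrib_left)
qed

lemma det_one_minus_tuples:
  fixes A :: "complex^'n^'n"
  shows "det (mat 1 - A) = (\<Sum>i\<le>CARD('n). (-1) ^ i / fact i *
    (\<Sum>f\<in>{..<i} \<rightarrow>\<^sub>E UNIV. \<Sum>p | p permutes {..<i}. of_int (sign p) * (\<Prod>j<i. A $ f j $ f (p j))))"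
proof -
  have "det (mat 1 - A) = (\<Sum>S\<in>UNIV. (-1) ^ card S * principal_minor A S)"
    by (rule det_one_minus)
  also have "\<dots> = (\<Sum>i\<le>CARD('n). \<Sum>S\<in>{S \<in> UNIV. card S = i}. (-1) ^ card S * principal_minor A S)"
    by (rule sum.group[symmetric]) (auto intro: card_mono)
  also have "\<dots> = (\<Sum>i\<le>CARD('n). (-1) ^ i * (\<Sum>S | card S = i. principal_minor A S))"
    by (simp add: sum_distrib_left)
  finally show ?thesis by (simp add: sum_tuples_principal_minor)
qed

definition hadj :: "complex^'n^'m \<Rightarrow> complex^'m^'n" where
  "hadj M = (\<chi> i j. cnj (M $ j $ i))"

lemma hadj_mult: "hadj (A ** B) = hadj B ** hadj A"
  by (simp add: hadj_def vec_eq_iff matrix_matrix_mult_def mult.commute)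

text \<open>With \<open>H\<close> the sum of \<open>g\<^sup>* g\<close> over a finite set stable under right multiplication by \<open>A\<close>,
  one has \<open>A\<^sup>* H A = H\<close>; hence \<open>H\<close> conjugates the inverse of \<open>A\<close> to \<open>A\<^sup>*\<close>.\<close>

lemma trace_inverse_eq_cnj:
  fixes A B :: "complex^'n^'n"
  assumes AB: "A ** B = mat 1" and S: "finite S" "mat 1 \<in> S" "\<And>g. g \<in> S \<Longrightarrow> g ** A \<in> S"
  shows "trace B = cnj (trace A)"
proof -
  define H where "H = (\<Sum>g\<in>S. hadj g ** g)"
  have right_A: "(g ** A) ** B = g" for g by (simp add: AB matrix_mul_assoc[symmetric])
  have inj: "inj_on (\<lambda>g. g ** A) S" by (rule inj_on_inverseI[of _ "\<lambda>g. g ** B"]) (rule right_A)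
  have im: "(\<lambda>g. g ** A) ` S = S"
    by (rule endo_inj_surj[OF S(1) _ inj]) (use S(3) in auto)

  have "hadj A ** H ** A = (\<Sum>g\<in>S. hadj (g ** A) ** (g ** A))"
    unfolding H_def matrix_mult_sum_left matrix_mult_sum_right
    by (simp add: hadj_mult matrix_mul_assoc)
  also have "\<dots> = (\<Sum>g\<in>(\<lambda>g. g ** A) ` S. hadj g ** g)"
    by (simp add: sum.reindex[OF inj])
  finally have HA: "hadj A ** H ** A = H" unfolding im H_def .
  then have "hadj A ** H ** (A ** B) = H ** B" by (simp add: matrix_mul_assoc)
  then have HB: "hadj A ** H = H ** B" by (simp add: AB)
  \<comment> \<open>H is positive definite: if \<open>H *v x\<close> vanishes, so does the sum of
    the squared norms of \<open>g *v x\<close> over \<open>S\<close>, and the identity matrix in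
    \<open>S\<close> contributes the squared norm of x.\<close>
  have ker: "x = 0" if "H *v x = 0" for x
  proof -
    have sq: "(\<Sum>i\<in>UNIV. cnj (x $ i) * ((hadj g ** g) *v x) $ i) = of_real ((norm (g *v x))\<^sup>2)" for g :: "complex^'n^'n"
    proof -
      have "(\<Sum>i\<in>UNIV. cnj (x $ i) * ((hadj g ** g) *v x) $ i)
          = (\<Sum>i\<in>UNIV. \<Sum>j\<in>UNIV. cnj (g $ j $ i * x $ i) * (g *v x) $ j)"
        unfolding matrix_vector_mul_assoc[symmetric]
      proof (rule sum.cong[OF refl])
        fix i
        have "(hadj g *v (g *v x)) $ i = (\<Sum>j\<in>UNIV. cnj (g $ j $ i) * (g *v x) $ j)"
          unfolding matrix_vector_mult_def[of "hadj g"] by (simp add: hadj_def)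
        then show "cnj (x $ i) * (hadj g *v (g *v x)) $ i =
            (\<Sum>j\<in>UNIV. cnj (g $ j $ i * x $ i) * (g *v x) $ j)"
          by (simp add: sum_distrib_left ac_simps)
      qed
      also have "\<dots> = (\<Sum>j\<in>UNIV. cnj ((g *v x) $ j) * (g *v x) $ j)"
        by (subst sum.swap) (simp add: matrix_vector_mult_def sum_distrib_right)
      also have "\<dots> = of_real (\<Sum>j\<in>UNIV. (norm ((g *v x) $ j))\<^sup>2)"
        by (simp only: of_real_sum complex_norm_square mult.commute)
      finally show ?thesis
        by (simp add: norm_vec_def L2_set_def real_sqrt_pow2 sum_nonneg)
    qed
    have "of_real (\<Sum>g\<in>S. (norm (g *v x))\<^sup>2) = (\<Sum>g\<in>S. \<Sum>i\<in>UNIV. cnj (x $ i) * ((hadj g ** g) *v x) $ i)"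
      by (simp add: sq)
    also have "\<dots> = (\<Sum>i\<in>UNIV. cnj (x $ i) * (H *v x) $ i)"
    proof (subst sum.swap, intro sum.cong refl)
      fix i
      have "(H *v x) $ i = (\<Sum>g\<in>S. ((hadj g ** g) *v x) $ i)"
        unfolding H_def matrix_vector_mult_def by (simp add: sum_distrib_right sum.swap[of _ S])
      then show "(\<Sum>g\<in>S. cnj (x $ i) * ((hadj g ** g) *v x) $ i) = cnj (x $ i) * (H *v x) $ i"
        by (simp add: sum_distrib_left)
    qed
    also have "\<dots> = of_real 0" by (simp add: that)
    finally have "(\<Sum>g\<in>S. (norm (g *v x))\<^sup>2) = 0" by (simp only: of_real_eq_iff)
    then have "(norm (mat 1 *v x))\<^sup>2 = 0"
      using S by (subst (asm) sum_nonneg_eq_0_iff) auto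
    then show ?thesis by simp
  qed
  then obtain K where K: "K ** H = mat 1"
    using matrix_left_invertible_ker[of H] by blast
  then have HK: "H ** K = mat 1" by (simp add: matrix_left_right_inverse)
  have "trace B = trace (K ** H ** B)" by (simp add: K)
  also have "\<dots> = trace (K ** (hadj A ** H))" by (simp add: HB matrix_mul_assoc)
  also have "\<dots> = trace (hadj A ** H ** K)" by (rule trace_mul_sym)
  also have "\<dots> = trace (hadj A)" by (simp add: HK matrix_mul_assoc[symmetric])
  also have "\<dots> = cnj (trace A)" by (simp add: trace_def hadj_def)
  finally show ?thesis .
qed

section \<open>The twisted Euler--Poincare pairing\<close>

lemma cscale_fun_apply [simp]: "cscale_fun c f vs = cscale c (f vs)"
  by (simp add: cscale_fun_def)

interpretation cochain: linear_space
  "cscale_fun :: complex \<Rightarrow> ('n::finite,'x::finite,'y::finite) cochain \<Rightarrow> _"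
  by unfold_locales
    (simp_all add: fun_eq_iff cscale.scale_right_distrib cscale.scale_left_distrib)

lemma cochain_linearI:
  fixes T :: "('n::finite,'x::finite,'y::finite) cochain \<Rightarrow> ('n,'x,'y) cochain"
  assumes "\<And>f g. T (f + g) = T f + T g" "\<And>c f. T (cscale_fun c f) = cscale_fun c (T f)"
  shows "Vector_Spaces.linear cscale_fun cscale_fun T"
  by unfold_locales (simp_all add: assms)

lemma sum_fun_apply: "(\<Sum>k\<in>K. F k) vs = (\<Sum>k\<in>K. F k vs :: 'b::comm_monoid_add)"
  by (induction K rule: infinite_finite_induct) simp_all

lemma cscale_sum_const: "(\<Sum>x\<in>A. M) = cscale (of_nat (card A)) M"
  by (induction A rule: infinite_finite_induct)
     (simp_all add: cscale.scale_left_distrib del: sum_constant)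

lemma matrix_mult_uminus: "(A::real^'n^'m) ** (- B) = - (A ** B)" "(- A) ** B = - (A ** B)"
  by (simp_all add: vec_eq_iff matrix_matrix_mult_def sum_negf)

lemma cmat_mult: "cmat (A ** B) = cmat A ** cmat B"
  by (simp add: cmat_def vec_eq_iff matrix_matrix_mult_def)

lemma cmv_mult: "cmv (A ** B) v = cmv A (cmv B v)"
  by (simp add: cmv_def cmat_mult matrix_vector_mul_assoc)

lemma cmv_one [simp]: "cmv (mat 1) v = (v :: complex^'n)"
proof -
  have "cmat (mat 1 :: real^'n^'n) = mat 1" by (simp add: cmat_def mat_def vec_eq_iff)
  then show ?thesis by (simp add: cmv_def)
qed

lemma cmv_add: "cmv A (u + v) = cmv A u + cmv A v"
  by (simp add: cmv_def matrix_vector_right_distrib)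

lemma cmv_scale: "cmv A (c *s v) = c *s cmv A v"
  by (simp add: cmv_def vec_eq_iff matrix_vector_mult_def sum_distrib_left ac_simps)

lemma thetaV_cmv: "thetaV w v = cmv (- w) v"
  by (simp add: thetaV_def cmv_def cmat_def vec_eq_iff matrix_vector_mult_def sum_negf)

lemma cmv_axis: "cmv A (axis m 1) $ r = cmat A $ r $ m"
  by (simp add: cmv_def matrix_vector_mult_def axis_def if_distrib cong: if_cong)

definition cvec :: "real^'n \<Rightarrow> complex^'n" where
  "cvec a = (\<chi> i. complex_of_real (a $ i))"

lemma cmv_sref: "cmv (sref cor a) v = v - cpair v (cor a) *s cvec a"
proof -
  have "(\<Sum>j\<in>UNIV. complex_of_real ((if i = j then 1 else 0) - a $ i * cor a $ j) * v $ j)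
      = v $ i - (\<Sum>j\<in>UNIV. v $ j * complex_of_real (cor a $ j)) * complex_of_real (a $ i)" for i
  proof -
    have "(\<Sum>j\<in>UNIV. complex_of_real ((if i = j then 1 else 0) - a $ i * cor a $ j) * v $ j)
        = (\<Sum>j\<in>UNIV. (if i = j then v $ j else 0) - (v $ j * complex_of_real (cor a $ j)) * complex_of_real (a $ i))"
      by (rule sum.cong) (auto simp: left_diff_distrib)
    then show ?thesis by (simp add: sum_subtractf sum_distrib_right)
  qed
  then show ?thesis
    by (simp add: cmv_def cmat_def sref_def refl_mat_def cpair_def cvec_def vec_eq_iff
        matrix_vector_mult_def)
qed

lemma cpair_add: "cpair (u + v) c = cpair u c + cpair v c"
  by (simp add: cpair_def algebra_simps sum.distrib)

lemma cpair_scale: "cpair (t *s v) c = t * cpair v c"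
  by (simp add: cpair_def sum_distrib_left mult.assoc)

lemma cpair_cvec: "cpair (cvec a) c = complex_of_real (a \<bullet> c)"
  by (simp add: cpair_def cvec_def inner_vec_def)

lemma omit_map: "omit j (\<lambda>l. g (vs l)) = (\<lambda>l. g (omit j vs l))"
  by (auto simp: omit_def)

lemma multilin_sum:
  assumes "\<And>r. r \<in> I \<Longrightarrow> multilin i (h r)"
  shows "multilin i (\<lambda>vs. \<Sum>r\<in>I. h r vs)"
  using assms unfolding multilin_def
  by (auto simp: sum.distrib cscale.scale_sum_right intro!: sum.cong simp del: fun_upd_apply)

lemma multilin_cscale:
  assumes "multilin i h"
  shows "multilin i (\<lambda>vs. cscale c (h vs))"
  unfolding multilin_def
proof (intro conjI allI impI)
  fix vs vs' :: "nat \<Rightarrow> complex^'a" assume "\<forall>j<i. vs j = vs' j"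
  then show "cscale c (h vs) = cscale c (h vs')"
    using multilin_cong[OF assms, of vs vs'] by simp
qed (simp_all only: multilin_add[OF assms] multilin_scale[OF assms] cscale.scale_right_distrib
      cscale.scale_left_commute)

lemma multilin_add_fun:
  assumes f: "multilin i f" and g: "multilin i g"
  shows "multilin i (\<lambda>vs. f vs + g vs)"
  unfolding multilin_def
proof (intro conjI allI impI)
  fix vs vs' :: "nat \<Rightarrow> complex^'a" assume "\<forall>j<i. vs j = vs' j"
  then show "f vs + g vs = f vs' + g vs'"
    using multilin_cong[OF f, of vs vs'] multilin_cong[OF g, of vs vs'] by simp
qed (simp_all only: multilin_add[OF f] multilin_scale[OF f] multilin_add[OF g] multilin_scale[OF g]
      cscale.scale_right_distrib ac_simps)

lemma multilin_transform:
  fixes psi :: "('n::finite,'x::finite,'y::finite) cochain" and u :: "real^'n^'n"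
  assumes m: "multilin i psi" and p: "p permutes {..<i}"
  shows "multilin i (\<lambda>vs. A ** psi (\<lambda>j. cmv u (vs (p j))) ** B)"
proof -
  \<comment> \<open>Slot \<open>j\<close> reads argument \<open>p j\<close>, so changing argument
    \<open>l\<close> changes slot \<open>inv p l\<close>.\<close>
  have upd: "(\<lambda>j. cmv u ((vs(l := x)) (p j))) = (\<lambda>j. cmv u (vs (p j)))(inv p l := cmv u x)"
    for vs :: "nat \<Rightarrow> complex^'n" and l x
    using permutes_inverses[OF p] by (auto simp: fun_eq_iff)
  have lt: "inv p l < i" if "l < i" for l
    using permutes_in_image[OF permutes_inv[OF p], of l] that by simp
  show ?thesis
    unfolding multilin_def
  proof (intro conjI allI impI)
    fix vs vs' :: "nat \<Rightarrow> complex^'n" assume eq: "\<forall>j<i. vs j = vs' j"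
    have "psi (\<lambda>j. cmv u (vs (p j))) = psi (\<lambda>j. cmv u (vs' (p j)))"
      using permutes_in_image[OF p] eq by (intro multilin_cong[OF m]) auto
    then show "A ** psi (\<lambda>j. cmv u (vs (p j))) ** B = A ** psi (\<lambda>j. cmv u (vs' (p j))) ** B"
      by simp
  qed (simp_all only: upd cmv_add cmv_scale multilin_add[OF m lt] multilin_scale[OF m lt]
      matrix_add_ldistrib matrix_mult_add_right cscale_matrix_mult_left cscale_matrix_mult_right)
qed

section \<open>Coordinates on multilinear maps\<close>

definition matrix_unit :: "'y \<Rightarrow> 'x \<Rightarrow> complex^'x^'y" where
  "matrix_unit a b = (\<chi> r c. if r = a \<and> c = b then 1 else 0)"

lemma matrix_unit_expand: "M = (\<Sum>a\<in>UNIV. \<Sum>b\<in>UNIV. cscale (M $ a $ b) (matrix_unit a b))"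
proof -
  have "(\<Sum>b\<in>UNIV. M $ a $ b * (if r = a \<and> c = b then 1 else 0)) = (if r = a then M $ a $ c else 0)" for a r c
    by (cases "r = a") (simp_all add: if_distrib[of "\<lambda>x. _ * x"] cong: if_cong)
  then have "(\<Sum>a\<in>UNIV. \<Sum>b\<in>UNIV. M $ a $ b * (if r = a \<and> c = b then 1 else 0)) = M $ r $ c" for r c
    by simp
  then show ?thesis by (simp add: vec_eq_iff matrix_unit_def)
qed

text \<open>Summed over a and b this is tr P times tr Q, the trace of the map sending M to P M
  Q.\<close>

lemma matrix_unit_sandwich: "(P ** matrix_unit a b ** Q) $ a $ b = P $ a $ a * Q $ b $ b"
proof -
  have "(P ** matrix_unit a b) $ a $ c = (if c = b then P $ a $ a else 0)" for c
    by (cases "c = b")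
       (simp_all add: matrix_matrix_mult_def matrix_unit_def if_distrib[of "\<lambda>x. _ * x"] cong: if_cong)
  then have "(P ** matrix_unit a b ** Q) $ a $ b = (\<Sum>c\<in>UNIV. (if c = b then P $ a $ a else 0) * Q $ c $ b)"
    by (simp add: matrix_matrix_mult_def[of "P ** matrix_unit a b"])
  also have "\<dots> = (\<Sum>c\<in>UNIV. if c = b then P $ a $ a * Q $ c $ b else 0)"
    by (intro sum.cong) auto
  finally show ?thesis by simp
qed

type_synonym ('n,'y,'x) form_index = "(nat \<Rightarrow> 'n) \<times> 'y \<times> 'x"

definition form_indices :: "nat \<Rightarrow> ('n,'y,'x) form_index set" where
  "form_indices i = ({..<i} \<rightarrow>\<^sub>E UNIV) \<times> UNIV \<times> UNIV"

text \<open>A tensor monomial in the coordinate functions with a matrix unit as value. It is neither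
  alternating nor equivariant; \<open>average\<close> repairs both.\<close>

definition elementary_form ::
    "nat \<Rightarrow> ('n,'y,'x) form_index \<Rightarrow> ('n::finite,'x::finite,'y::finite) cochain" where
  "elementary_form i = (\<lambda>(f, a, b) vs. cscale (\<Prod>j<i. vs j $ f j) (matrix_unit a b))"

definition form_coeff ::
    "('n,'y,'x) form_index \<Rightarrow> ('n::finite,'x::finite,'y::finite) cochain \<Rightarrow> complex" where
  "form_coeff = (\<lambda>(f, a, b) psi. psi (\<lambda>j. axis (f j) 1) $ a $ b)"

lemma finite_form_indices: "finite (form_indices i :: ('n::finite,'y::finite,'x::finite) form_index set)"
  unfolding form_indices_def by (intro finite_cartesian_product finite_PiE) auto

lemma sum_form_indices: "(\<Sum>q\<in>form_indices i. F q) =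
    (\<Sum>f\<in>{..<i} \<rightarrow>\<^sub>E UNIV. \<Sum>a\<in>UNIV. \<Sum>b\<in>UNIV. F (f, a, b))"
  by (simp add: form_indices_def sum.cartesian_product case_prod_beta)

lemma multilin_elementary_form: "multilin i (elementary_form i q)"
proof -
  obtain f a b where q: "q = (f, a, b)" by (cases q)
  have upd: "(\<Prod>j<i. (vs(l := x)) j $ f j) = x $ f l * (\<Prod>j\<in>{..<i} - {l}. vs j $ f j)"
    if "l < i" for l and vs :: "nat \<Rightarrow> complex^'a" and x
  proof -
    have "(\<Prod>j<i. (vs(l := x)) j $ f j) = (vs(l := x)) l $ f l * (\<Prod>j\<in>{..<i} - {l}. (vs(l := x)) j $ f j)"
      using that by (intro prod.remove) auto
    also have "(\<Prod>j\<in>{..<i} - {l}. (vs(l := x)) j $ f j) = (\<Prod>j\<in>{..<i} - {l}. vs j $ f j)"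
      by (intro prod.cong) auto
    finally show ?thesis by simp
  qed
  show ?thesis
    unfolding multilin_def elementary_form_def q prod.case
  proof (intro conjI allI impI)
    fix vs vs' :: "nat \<Rightarrow> complex^'a" assume "\<forall>j<i. vs j = vs' j"
    then have "(\<Prod>j<i. vs j $ f j) = (\<Prod>j<i. vs' j $ f j)" by (intro prod.cong) auto
    then show "cscale (\<Prod>j<i. vs j $ f j) (matrix_unit a b) = cscale (\<Prod>j<i. vs' j $ f j) (matrix_unit a b)"
      by simp
  qed (simp_all add: upd algebra_simps cscale.scale_left_distrib del: fun_upd_apply)
qed

lemma multilin_elementary_expand:
  fixes psi :: "('n::finite,'x::finite,'y::finite) cochain"
  assumes m: "multilin i psi"
  shows "psi = (\<Sum>q\<in>form_indices i. cscale_fun (form_coeff q psi) (elementary_form i q))"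
proof
  fix vs
  have "psi vs = (\<Sum>f\<in>{..<i} \<rightarrow>\<^sub>E UNIV. cscale (\<Prod>j<i. vs j $ f j) (psi (\<lambda>j. axis (f j) 1)))"
    by (rule multilin_expand[OF m])
  also have "\<dots> = (\<Sum>f\<in>{..<i} \<rightarrow>\<^sub>E UNIV. \<Sum>a\<in>UNIV. \<Sum>b\<in>UNIV.
      cscale (form_coeff (f, a, b) psi) (elementary_form i (f, a, b) vs))"
  proof (rule sum.cong[OF refl])
    fix f :: "nat \<Rightarrow> 'n"
    let ?M = "psi (\<lambda>j. axis (f j) 1)"
    have "cscale (\<Prod>j<i. vs j $ f j) ?M = cscale (\<Prod>j<i. vs j $ f j)
        (\<Sum>a\<in>UNIV. \<Sum>b\<in>UNIV. cscale (?M $ a $ b) (matrix_unit a b))"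
      using matrix_unit_expand[of ?M] by simp
    also have "\<dots> = (\<Sum>a\<in>UNIV. \<Sum>b\<in>UNIV. cscale (form_coeff (f, a, b) psi) (elementary_form i (f, a, b) vs))"
      unfolding elementary_form_def form_coeff_def prod.case cscale.scale_sum_right
      by (intro sum.cong refl) (rule cscale.scale_left_commute)
    finally show "cscale (\<Prod>j<i. vs j $ f j) ?M =
        (\<Sum>a\<in>UNIV. \<Sum>b\<in>UNIV. cscale (form_coeff (f, a, b) psi) (elementary_form i (f, a, b) vs))" .
  qed
  also have "\<dots> = (\<Sum>q\<in>form_indices i. cscale_fun (form_coeff q psi) (elementary_form i q)) vs"
    unfolding sum_fun_apply sum_form_indices cscale_fun_apply ..
  finally show "psi vs = (\<Sum>q\<in>form_indices i. cscale_fun (form_coeff q psi) (elementary_form i q)) vs" .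
qed

text \<open>The cross relation is solved for the product of reflection and vector, the form in which
  it moves the reflection to the right.\<close>

lemma H_theta_moduleD:
  assumes "H_theta_module R cor D k tX vX ThX"
  shows "tX (mat 1) = mat 1"
    "\<And>w u. w \<in> weyl R cor \<Longrightarrow> u \<in> weyl R cor \<Longrightarrow> tX (w ** u) = tX w ** tX u"
    "\<And>a b. vX (a + b) = vX a + vX b" "\<And>c a. vX (c *s a) = cscale c (vX a)"
    "\<And>a b. vX a ** vX b = vX b ** vX a"
    "\<And>a v. a \<in> D \<Longrightarrow> tX (sref cor a) ** vX v =
       vX (cmv (sref cor a) v) ** tX (sref cor a)
       + cscale (complex_of_real (k a) * cpair v (cor a)) (mat 1)"
    "ThX ** ThX = mat 1"
    "\<And>w. w \<in> weyl R cor \<Longrightarrow>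
       ThX ** tX w ** ThX = tX (longest R cor D ** w ** matrix_inv (longest R cor D))"
    "\<And>v. ThX ** vX v ** ThX = vX (thetaV (longest R cor D) v)"
proof -
  note m = assms[unfolded H_theta_module_def Let_def]
  show "tX (mat 1) = mat 1" "ThX ** ThX = mat 1"
    "\<And>w u. w \<in> weyl R cor \<Longrightarrow> u \<in> weyl R cor \<Longrightarrow> tX (w ** u) = tX w ** tX u"
    "\<And>a b. vX (a + b) = vX a + vX b" "\<And>c a. vX (c *s a) = cscale c (vX a)"
    "\<And>a b. vX a ** vX b = vX b ** vX a"
    "\<And>w. w \<in> weyl R cor \<Longrightarrow>
       ThX ** tX w ** ThX = tX (longest R cor D ** w ** matrix_inv (longest R cor D))"
    "\<And>v. ThX ** vX v ** ThX = vX (thetaV (longest R cor D) v)"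
    using m by blast+
  fix a v assume "a \<in> D"
  then have "tX (sref cor a) ** vX v - vX (cmv (sref cor a) v) ** tX (sref cor a)
      = cscale (complex_of_real (k a) * cpair v (cor a)) (mat 1)"
    using m by blast
  then show "tX (sref cor a) ** vX v = vX (cmv (sref cor a) v) ** tX (sref cor a)
      + cscale (complex_of_real (k a) * cpair v (cor a)) (mat 1)"
    by (simp only: diff_eq_eq add.commute[of "cscale _ _"])
qed

locale twisted_module_pair = based_root_system R D cor
  for R D :: "(real^'n::finite) set" and cor :: "real^'n \<Rightarrow> real^'n" +
  fixes k :: "real^'n \<Rightarrow> real"
    and tX :: "real^'n^'n \<Rightarrow> complex^'x::finite^'x" and vX :: "complex^'n \<Rightarrow> complex^'x^'x"
    and ThX :: "complex^'x^'x"
    and tY :: "real^'n^'n \<Rightarrow> complex^'y::finite^'y" and vY :: "complex^'n \<Rightarrow> complex^'y^'y"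
    and ThY :: "complex^'y^'y"
  assumes module_X: "H_theta_module R cor D k tX vX ThX"
    and module_Y: "H_theta_module R cor D k tY vY ThY"
begin

abbreviation w0 where "w0 \<equiv> longest R cor D"
abbreviation cochain_space where "cochain_space \<equiv> cochains R cor tX tY"
abbreviation theta where "theta \<equiv> theta_star w0 ThX ThY"

lemmas X = H_theta_moduleD[OF module_X]
lemmas Y = H_theta_moduleD[OF module_Y]

lemma tY_inv:
  assumes "u \<in> W"
  shows "tY (matrix_inv u) ** tY u = mat 1" "tY u ** tY (matrix_inv u) = mat 1"
  using Y(2)[OF weyl_matrix_inv(1)[OF assms] assms] Y(2)[OF assms weyl_matrix_inv(1)[OF assms]]
  by (simp_all add: weyl_matrix_inv[OF assms] Y(1))

lemma cochains_iff: "psi \<in> cochain_space i \<longleftrightarrow> altmap i psi \<and>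
    (\<forall>w\<in>W. \<forall>vs. psi (\<lambda>j. cmv w (vs j)) ** tX w = tY w ** psi vs)"
  unfolding cochains_def altmap_def multilin_def mem_Collect_eq conj_assoc ..

lemma cochain_equivariant:
  "psi \<in> cochain_space i \<Longrightarrow> w \<in> W \<Longrightarrow> psi (\<lambda>j. cmv w (vs j)) ** tX w = tY w ** psi vs"
  unfolding cochains_iff by blast

section \<open>The differential and theta on equivariant cochains\<close>

definition dop :: "complex^'n \<Rightarrow> complex^'x^'y \<Rightarrow> complex^'x^'y" where
  "dop v M = vY v ** M - M ** vX v"

lemma dstar_koszul: "dstar vX vY i psi = koszul dop i psi"
  unfolding dstar_def koszul_def dop_def ..

lemma bilin_dop: "bilin dop"
  unfolding bilin_def dop_def
  unfolding X(3,4) Y(3,4) matrix_add_ldistrib matrix_mult_add_right cscale_matrix_mult_left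
    cscale_matrix_mult_right cscale.scale_right_diff_distrib
  by (simp add: add_diff_add)

lemma dop_commute: "dop u (dop v M) = dop v (dop u M)"
proof -
  have 1: "vY u ** (vY v ** M) = vY v ** (vY u ** M)"
    by (simp add: matrix_mul_assoc Y(5)[of u v])
  have 2: "(M ** vX v) ** vX u = (M ** vX u) ** vX v"
    by (simp add: matrix_mul_assoc[symmetric] X(5)[of u v])
  show ?thesis
    unfolding dop_def matrix_mult_diff_left matrix_mult_diff_right 1 2
    by (simp add: matrix_mul_assoc)
qed

text \<open>Here \<open>M\<close> stands for a value of the cochain and \<open>M'\<close> for its
  value at the reflected arguments. Crossing the vector leaves a multiple of \<open>M\<close> from
  the action on Y and the same multiple of \<open>M'\<close> from the action on X.\<close>

lemma sref_dop:
  assumes a: "a \<in> D" and M: "M' ** tX (sref cor a) = tY (sref cor a) ** M"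
  shows "tY (sref cor a) ** dop v M = dop (cmv (sref cor a) v) M' ** tX (sref cor a)
    + cscale (complex_of_real (k a) * cpair v (cor a)) (M - M')"
proof -
  let ?s = "sref cor a" and ?c = "complex_of_real (k a) * cpair v (cor a)"
  have "tY ?s ** (vY v ** M) = vY (cmv ?s v) ** (tY ?s ** M) + cscale ?c M"
    by (simp add: matrix_mul_assoc Y(6)[OF a] matrix_mult_add_right cscale_matrix_mult_left)
  also have "tY ?s ** M = M' ** tX ?s" by (rule M[symmetric])
  finally have 1: "tY ?s ** (vY v ** M) = vY (cmv ?s v) ** (M' ** tX ?s) + cscale ?c M" .
  have "tY ?s ** (M ** vX v) = M' ** (tX ?s ** vX v)"
    by (simp add: matrix_mul_assoc M)
  also have "\<dots> = M' ** (vX (cmv ?s v) ** tX ?s) + cscale ?c M'"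
    by (simp add: X(6)[OF a] matrix_add_ldistrib cscale_matrix_mult_right)
  finally show ?thesis
    unfolding dop_def matrix_mult_diff_left matrix_mult_diff_right 1
    by (simp add: matrix_mul_assoc cscale.scale_right_diff_distrib)
qed

text \<open>No single summand is equivariant. The corrections from \<open>sref_dop\<close> cancel
  only in the sum over the omitted slot, by \<open>koszul_reflection_invariant\<close>.\<close>

lemma koszul_sref_equivariant:
  assumes a: "a \<in> D" and psi: "psi \<in> cochain_space i"
  shows "koszul dop i psi (\<lambda>j. cmv (sref cor a) (vs j)) ** tX (sref cor a)
    = tY (sref cor a) ** koszul dop i psi vs"
proof -
  let ?s = "sref cor a" and ?L = "\<lambda>v. cpair v (cor a)"
  let ?M = "\<lambda>j. psi (omit j vs)" and ?M' = "\<lambda>j. psi (\<lambda>l. cmv ?s (omit j vs l))"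
  have aR: "a \<in> R" and sW: "?s \<in> W" using a simple_root sref_weyl by auto
  have alt: "altmap i psi" using psi cochains_iff by blast
  have M: "?M' j ** tX ?s = tY ?s ** ?M j" for j
    by (rule cochain_equivariant[OF psi sW])
  have "?L (cvec a) = 2" by (simp add: cpair_cvec coroot_self[OF aR])
  from koszul_reflection_invariant[of ?L, OF cpair_add cpair_scale this alt, of vs]
  have inv: "(\<Sum>j<Suc i. cscale ((-1) ^ (j + 1)) (cscale (?L (vs j)) (?M' j)))
      = (\<Sum>j<Suc i. cscale ((-1) ^ (j + 1)) (cscale (?L (vs j)) (?M j)))"
    unfolding cmv_sref .
  have summand: "tY ?s ** cscale c (dop (vs j) (?M j)) = cscale c (dop (cmv ?s (vs j)) (?M' j)) ** tX ?s
      + cscale (complex_of_real (k a)) (cscale c (cscale (?L (vs j)) (?M j))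
          - cscale c (cscale (?L (vs j)) (?M' j)))" for c j
    unfolding cscale_matrix_mult_right cscale_matrix_mult_left sref_dop[OF a M]
      cscale.scale_right_distrib cscale.scale_right_diff_distrib cscale.scale_scale
    by (simp add: ac_simps)
  have "tY ?s ** koszul dop i psi vs = koszul dop i psi (\<lambda>j. cmv ?s (vs j)) ** tX ?s
      + cscale (complex_of_real (k a)) ((\<Sum>j<Suc i. cscale ((-1) ^ (j + 1)) (cscale (?L (vs j)) (?M j)))
        - (\<Sum>j<Suc i. cscale ((-1) ^ (j + 1)) (cscale (?L (vs j)) (?M' j))))"
    unfolding koszul_def omit_map matrix_mult_sum_left matrix_mult_sum_right summand sum.distrib
      sum_subtractf[symmetric] cscale.scale_sum_right ..
  then show ?thesis unfolding inv by simp
qed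

text \<open>The Hecke relation speaks of simple reflections alone; equivariance for all of
  \<open>W\<close> follows by composing along a word.\<close>

lemma dstar_cochain:
  assumes psi: "psi \<in> cochain_space i"
  shows "dstar vX vY i psi \<in> cochain_space (Suc i)"
proof -
  have "altmap (Suc i) (koszul dop i psi)"
    using altmap_koszul[OF bilin_dop] psi cochains_iff by blast
  moreover have "koszul dop i psi (\<lambda>j. cmv (wp as) (vs j)) ** tX (wp as) = tY (wp as) ** koszul dop i psi vs"
    if "set as \<subseteq> D" for as vs
    using that
  proof (induction as arbitrary: vs)
    case Nil
    show ?case by (simp add: X(1) Y(1))
  next
    case (Cons a as)
    then have a: "a \<in> D" and as: "set as \<subseteq> D" by auto
    have W: "sref cor a \<in> W" "wp as \<in> W"
      using a as simple_root sref_weyl word_prod_weyl by auto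
    have "koszul dop i psi (\<lambda>j. cmv (wp (a # as)) (vs j)) ** tX (wp (a # as))
        = koszul dop i psi (\<lambda>j. cmv (sref cor a) (cmv (wp as) (vs j))) ** tX (sref cor a) ** tX (wp as)"
      by (simp add: cmv_mult X(2)[OF W] matrix_mul_assoc)
    also have "\<dots> = tY (sref cor a) ** (koszul dop i psi (\<lambda>j. cmv (wp as) (vs j)) ** tX (wp as))"
      using koszul_sref_equivariant[OF a psi, of "\<lambda>j. cmv (wp as) (vs j)"]
      by (simp add: matrix_mul_assoc)
    also have "\<dots> = tY (wp (a # as)) ** koszul dop i psi vs"
      unfolding Cons.IH[OF as] by (simp add: Y(2)[OF W] matrix_mul_assoc)
    finally show ?case .
  qed
  ultimately show ?thesis
    unfolding dstar_koszul cochains_iff using weyl_word by blast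
qed

lemma dstar_dstar: "dstar vX vY (Suc i) (dstar vX vY i psi) = 0"
  unfolding dstar_koszul by (rule koszul_koszul[OF bilin_dop dop_commute])

lemma linear_dstar: "Vector_Spaces.linear cscale_fun cscale_fun (dstar vX vY i)"
proof (rule cochain_linearI; rule ext)
  fix f g :: "('n,'x,'y) cochain" and c vs
  show "dstar vX vY i (f + g) vs = (dstar vX vY i f + dstar vX vY i g) vs"
    unfolding dstar_koszul koszul_def plus_fun_apply bilinD[OF bilin_dop]
      cscale.scale_right_distrib sum.distrib ..
  show "dstar vX vY i (cscale_fun c f) vs = cscale_fun c (dstar vX vY i f) vs"
    unfolding dstar_koszul koszul_def cscale_fun_apply bilinD[OF bilin_dop] cscale.scale_sum_right
    by (intro sum.cong refl cscale.scale_left_commute)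
qed

lemma linear_theta: "Vector_Spaces.linear cscale_fun cscale_fun theta"
  by (rule cochain_linearI)
     (simp_all add: theta_star_def fun_eq_iff matrix_add_ldistrib matrix_mult_add_right
       cscale_matrix_mult_left cscale_matrix_mult_right)

lemma Th_tX: "w \<in> W \<Longrightarrow> ThX ** tX w = tX (w0 ** w ** matrix_inv w0) ** ThX"
  using arg_cong[OF X(8), of w "\<lambda>M. M ** ThX"] by (simp add: matrix_mul_assoc[symmetric] X(7))

lemma Th_tY: "w \<in> W \<Longrightarrow> ThY ** tY (w0 ** w ** matrix_inv w0) = tY w ** ThY"
  using arg_cong[OF Y(8), of w "\<lambda>M. ThY ** M"] by (simp add: matrix_mul_assoc Y(7))

lemma theta_cochain:
  assumes psi: "psi \<in> cochain_space i"
  shows "theta psi \<in> cochain_space i"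
proof -
  have alt: "altmap i psi" using psi cochains_iff by blast
  have "multilin i (\<lambda>vs. ThY ** psi (\<lambda>j. cmv (- w0) (vs (id j))) ** ThX)"
    by (rule multilin_transform[OF altmap_multilin[OF alt] permutes_id])
  then have "multilin i (theta psi)"
    by (simp add: theta_star_def thetaV_cmv)
  moreover have "theta psi vs = 0" if "j < l" "l < i" "vs j = vs l" for vs j l
    using that altmap_zero[OF alt, of j l "\<lambda>j. thetaV w0 (vs j)"] by (simp add: theta_star_def)
  moreover have "theta psi (\<lambda>j. cmv w (vs j)) ** tX w = tY w ** theta psi vs" if w: "w \<in> W" for w vs
  proof -
    let ?w = "w0 ** w ** matrix_inv w0"
    have w': "?w \<in> W" using w longest_weyl by (intro weyl_mult weyl_matrix_inv)
    \<comment> \<open>On V theta is -w0, so moving it past w replaces w by its conjugate under w0,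
      in step with the rules for theta on X and Y.\<close>
    have "?w ** (- w0) = - (w0 ** w ** (matrix_inv w0 ** w0))"
      by (simp add: matrix_mul_assoc matrix_mult_uminus)
    also have "\<dots> = (- w0) ** w"
      using weyl_matrix_inv(2)[OF longest_weyl] by (simp add: matrix_mult_uminus)
    finally have "cmv (- w0) (cmv w v) = cmv ?w (cmv (- w0) v)" for v
      by (simp only: cmv_mult[symmetric])
    then have "theta psi (\<lambda>j. cmv w (vs j)) ** tX w
        = ThY ** psi (\<lambda>j. cmv ?w (cmv (- w0) (vs j))) ** (ThX ** tX w)"
      by (simp add: theta_star_def thetaV_cmv matrix_mul_assoc)
    also have "\<dots> = ThY ** (psi (\<lambda>j. cmv ?w (cmv (- w0) (vs j))) ** tX ?w) ** ThX"
      by (simp only: Th_tX[OF w] matrix_mul_assoc)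
    also have "psi (\<lambda>j. cmv ?w (cmv (- w0) (vs j))) ** tX ?w = tY ?w ** psi (\<lambda>j. cmv (- w0) (vs j))"
      by (rule cochain_equivariant[OF psi w'])
    also have "ThY ** (tY ?w ** psi (\<lambda>j. cmv (- w0) (vs j))) ** ThX = tY w ** theta psi vs"
      by (simp add: matrix_mul_assoc Th_tY[OF w] theta_star_def thetaV_cmv)
    finally show ?thesis .
  qed
  ultimately show ?thesis unfolding cochains_iff altmap_def by blast
qed

lemma theta_dstar: "dstar vX vY i (theta psi) = theta (dstar vX vY i psi)"
proof
  fix vs
  have Yv: "ThY ** vY (thetaV w0 v) = vY v ** ThY" for v
    using arg_cong[OF Y(9)[of v], of "\<lambda>M. ThY ** M"] by (simp add: matrix_mul_assoc Y(7))
  have Xv: "vX (thetaV w0 v) ** ThX = ThX ** vX v" for v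
    using arg_cong[OF X(9)[of v], of "\<lambda>M. M ** ThX"] by (simp add: matrix_mul_assoc[symmetric] X(7))
  have dop_theta: "ThY ** dop (thetaV w0 v) M ** ThX = dop v (ThY ** M ** ThX)" for v M
  proof -
    have "ThY ** (vY (thetaV w0 v) ** M) ** ThX = vY v ** (ThY ** M ** ThX)"
      by (simp add: matrix_mul_assoc Yv)
    moreover have "ThY ** (M ** vX (thetaV w0 v)) ** ThX = ThY ** M ** ThX ** vX v"
      by (simp add: matrix_mul_assoc[symmetric] Xv)
    ultimately show ?thesis
      by (simp add: dop_def matrix_mult_diff_left matrix_mult_diff_right)
  qed
  show "dstar vX vY i (theta psi) vs = theta (dstar vX vY i psi) vs"
    unfolding dstar_koszul koszul_def theta_star_def omit_map matrix_mult_sum_left matrix_mult_sum_right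
      cscale_matrix_mult_left cscale_matrix_mult_right dop_theta ..
qed

lemma subspace_cochains: "cochain.subspace (cochain_space i)"
proof (rule cochain.subspaceI)
  show "0 \<in> cochain_space i"
    by (simp add: cochains_iff altmap_def multilin_def)
next
  fix f g assume f: "f \<in> cochain_space i" and g: "g \<in> cochain_space i"
  have "multilin i (f + g)"
    using f g multilin_add_fun[of i f g] unfolding cochains_iff altmap_def plus_fun_def by blast
  then show "f + g \<in> cochain_space i"
    using f g unfolding cochains_iff altmap_def
    by (auto simp: matrix_add_ldistrib matrix_mult_add_right)
next
  fix c f assume f: "f \<in> cochain_space i"
  have "multilin i (cscale_fun c f)"
    using f multilin_cscale[of i f c] unfolding cochains_iff altmap_def cscale_fun_def by blast
  then show "cscale_fun c f \<in> cochain_space i"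
    using f unfolding cochains_iff altmap_def
    by (auto simp: cscale_matrix_mult_left cscale_matrix_mult_right)
qed

section \<open>The averaging projector and its trace\<close>

text \<open>Averaging over \<open>W\<close> and antisymmetrisation at once: by
  \<open>average_cochain\<close> and \<open>average_fixes\<close> a projection of the multilinear
  maps onto the cochains.\<close>

definition average :: "nat \<Rightarrow> ('n,'x,'y) cochain \<Rightarrow> ('n,'x,'y) cochain" where
  "average i psi = (\<lambda>vs. cscale (1 / (of_nat (card W) * fact i)) (\<Sum>u\<in>W. \<Sum>p | p permutes {..<i}.
     cscale (of_int (sign p)) (tY (matrix_inv u) ** psi (\<lambda>j. cmv u (vs (p j))) ** tX u)))"

lemma linear_average: "Vector_Spaces.linear cscale_fun cscale_fun (average i)"
  by (rule cochain_linearI)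
     (simp_all add: average_def fun_eq_iff matrix_add_ldistrib matrix_mult_add_right
       cscale_matrix_mult_left cscale_matrix_mult_right cscale.scale_right_distrib sum.distrib
       cscale.scale_sum_right ac_simps)

lemma average_cochain:
  assumes m: "multilin i psi"
  shows "average i psi \<in> cochain_space i"
proof -
  have "multilin i (average i psi)"
    unfolding average_def
    by (intro multilin_cscale multilin_sum multilin_transform m) simp
  moreover have "average i psi vs = 0" if jl: "j < l" "l < i" "vs j = vs l" for vs j l
  proof -
    have t: "vs (Transposition.transpose j l x) = vs x" for x
      using jl by (simp add: Transposition.transpose_def)
    have "(\<Sum>p | p permutes {..<i}.
        cscale (of_int (sign p)) (tY (matrix_inv u) ** psi (\<lambda>j. cmv u (vs (p j))) ** tX u)) = 0" for u
    proof (rule sum_permutes_antisymmetric[of j _ l])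
      fix p assume p: "p permutes {..<i}"
      then have "permutation p" by (auto intro: permutes_imp_permutation)
      then have "sign (Transposition.transpose j l \<circ> p) = - sign p"
        using jl by (simp add: sign_compose permutation_swap_id sign_swap_id)
      then show "cscale (of_int (sign (Transposition.transpose j l \<circ> p)))
          (tY (matrix_inv u) ** psi (\<lambda>j'. cmv u (vs ((Transposition.transpose j l \<circ> p) j'))) ** tX u) =
          - cscale (of_int (sign p)) (tY (matrix_inv u) ** psi (\<lambda>j. cmv u (vs (p j))) ** tX u)"
        by (simp add: t)
    qed (use jl in auto)
    then show ?thesis by (simp add: average_def)
  qed
  moreover have "average i psi (\<lambda>j. cmv w (vs j)) ** tX w = tY w ** average i psi vs"
    if w: "w \<in> W" for w vs
  proof -
    let ?F = "\<lambda>u. \<Sum>p | p permutes {..<i}.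
      cscale (of_int (sign p)) (tY (matrix_inv u) ** psi (\<lambda>j. cmv u (vs (p j))) ** tX u)"
    \<comment> \<open>Applying w to the arguments replaces u by u w; the compensating factor tY w
      comes out on the left because the inverse of u equals w times the inverse of u w.\<close>
    have step: "(\<Sum>p | p permutes {..<i}. cscale (of_int (sign p))
        (tY (matrix_inv u) ** psi (\<lambda>j. cmv u (cmv w (vs (p j)))) ** tX u)) ** tX w = tY w ** ?F (u ** w)"
      if u: "u \<in> W" for u
    proof -
      have uw: "u ** w \<in> W" using u w by (rule weyl_mult)
      have "w ** matrix_inv (u ** w) = matrix_inv u ** (u ** w) ** matrix_inv (u ** w)"
        by (simp add: matrix_mul_assoc weyl_matrix_inv[OF u])
      also have "\<dots> = matrix_inv u"
        by (simp only: matrix_mul_assoc[symmetric, of "matrix_inv u"] weyl_matrix_inv[OF uw] matrix_mul_rid)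
      finally have inv: "tY w ** tY (matrix_inv (u ** w)) = tY (matrix_inv u)"
        using Y(2)[OF w weyl_matrix_inv(1)[OF uw]] by simp
      have "tY (matrix_inv u) ** M ** tX u ** tX w = tY w ** (tY (matrix_inv (u ** w)) ** M ** tX (u ** w))" for M
        by (simp add: matrix_mul_assoc inv X(2)[OF u w])
      then show ?thesis
        by (simp add: matrix_mult_sum_left matrix_mult_sum_right cscale_matrix_mult_left
            cscale_matrix_mult_right cmv_mult)
    qed
    have "(\<Sum>u\<in>W. \<Sum>p | p permutes {..<i}. cscale (of_int (sign p))
        (tY (matrix_inv u) ** psi (\<lambda>j. cmv u (cmv w (vs (p j)))) ** tX u)) ** tX w
        = (\<Sum>u\<in>W. tY w ** ?F (u ** w))"
      unfolding matrix_mult_sum_right[of _ W] by (intro sum.cong refl step)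
    also have "\<dots> = (\<Sum>u\<in>W. tY w ** ?F u)"
      by (rule sum.reindex_bij_witness[of _ "\<lambda>u. u ** matrix_inv w" "\<lambda>u. u ** w"])
         (auto simp: weyl_mult w weyl_matrix_inv matrix_mul_assoc[symmetric])
    finally show ?thesis
      unfolding average_def cscale_matrix_mult_left cscale_matrix_mult_right
        matrix_mult_sum_left[of "tY w" _ W] by simp
  qed
  ultimately show ?thesis unfolding cochains_iff altmap_def by blast
qed

lemma average_fixes:
  assumes psi: "psi \<in> cochain_space i"
  shows "average i psi = psi"
proof
  fix vs
  have alt: "altmap i psi" using psi cochains_iff by blast
  have "cscale (of_int (sign p)) (tY (matrix_inv u) ** psi (\<lambda>j. cmv u (vs (p j))) ** tX u) = psi vs"
    if u: "u \<in> W" and p: "p permutes {..<i}" for u p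
  proof -
    have "psi (\<lambda>j. cmv u (vs (p j))) = cscale (of_int (sign p)) (psi (\<lambda>j. cmv u (vs j)))"
      using altmap_permute[OF alt p, of "\<lambda>j. cmv u (vs j)"] by (simp add: o_def)
    moreover have "psi (\<lambda>j. cmv u (vs j)) ** tX u = tY u ** psi vs"
      by (rule cochain_equivariant[OF psi u])
    moreover have "of_int (sign p) * of_int (sign p) = (1::complex)"
      by (simp add: sign_def)
    ultimately show ?thesis
      by (simp add: cscale_matrix_mult_left cscale_matrix_mult_right matrix_mul_assoc[symmetric])
         (simp add: matrix_mul_assoc tY_inv[OF u])
  qed
  then have "average i psi vs = cscale (1 / (of_nat (card W) * fact i))
      (\<Sum>u\<in>W. \<Sum>p | p permutes {..<i}. psi vs)"
    unfolding average_def by simp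
  also have "\<dots> = cscale (1 / (of_nat (card W) * fact i) * (of_nat (card W) * fact i)) (psi vs)"
    by (simp add: cscale_sum_const card_permutations[OF card_lessThan] del: sum_constant)
  also have "\<dots> = psi vs"
  proof -
    have "of_nat (card W) * fact i \<noteq> (0::complex)"
      using finite_weyl weyl_one[of R cor] by (auto simp: card_eq_0_iff)
    then show ?thesis by simp
  qed
  finally show "average i psi vs = psi vs" .
qed

text \<open>A cochain is expanded in monomials as a mere multilinear map, and then the average is
  applied to both sides: it fixes the cochain and sends the monomials to cochains, keeping the
  coefficients.\<close>

lemma frame_cochains:
  "cochain.frame (cochain_space i) (form_indices i) (\<lambda>q. average i (elementary_form i q)) form_coeff"
  unfolding cochain.frame_def
proof (intro conjI ballI allI)
  show "finite (form_indices i :: ('n,'y,'x) form_index set)" by (rule finite_form_indices)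
next
  fix psi assume psi: "psi \<in> cochain_space i"
  interpret av: Vector_Spaces.linear cscale_fun cscale_fun "average i" by (rule linear_average)
  have m: "multilin i psi" using psi unfolding cochains_iff by (blast intro: altmap_multilin)
  have "psi = average i psi" by (rule average_fixes[OF psi, symmetric])
  also have "\<dots> = average i (\<Sum>q\<in>form_indices i. cscale_fun (form_coeff q psi) (elementary_form i q))"
    by (rule arg_cong[OF multilin_elementary_expand[OF m]])
  also have "\<dots> = (\<Sum>q\<in>form_indices i. cscale_fun (form_coeff q psi) (average i (elementary_form i q)))"
    unfolding av.sum av.scale ..
  finally show "psi = (\<Sum>q\<in>form_indices i. cscale_fun (form_coeff q psi) (average i (elementary_form i q)))" .
next
  fix q :: "('n,'y,'x) form_index"
  show "average i (elementary_form i q) \<in> cochain_space i"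
    by (rule average_cochain[OF multilin_elementary_form])
  show "form_coeff q (f + g) = form_coeff q f + form_coeff q g" for f g
    by (simp add: form_coeff_def case_prod_beta)
  show "form_coeff q (cscale_fun c f) = c * form_coeff q f" for c f
    by (simp add: form_coeff_def case_prod_beta)
qed

lemma fin_dim_cochains: "cochain.fin_dim (cochain_space i)"
proof -
  let ?E = "(\<lambda>q. average i (elementary_form i q)) ` (form_indices i :: ('n,'y,'x) form_index set)"
  have "psi \<in> cochain.span ?E" if "psi \<in> cochain_space i" for psi
  proof -
    have "psi = (\<Sum>q\<in>form_indices i. cscale_fun (form_coeff q psi) (average i (elementary_form i q)))"
      using frame_cochains[of i] that unfolding cochain.frame_def by blast
    also have "\<dots> \<in> cochain.span ?E"
      by (intro cochain.span_sum cochain.span_scale cochain.span_base imageI)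
    finally show ?thesis .
  qed
  moreover have "finite ?E" by (intro finite_imageI finite_form_indices)
  ultimately show ?thesis
    unfolding cochain.fin_dim_def using subspace_cochains by blast
qed

text \<open>In the frame each coefficient factors into a diagonal entry on Y, one on X, and a
  product of entries of u theta on V. Summing over the matrix units gives the two traces; summing
  over tuples gives i! times the trace on the i-th exterior power.\<close>

lemma trace_theta_cochains:
  "cochain.trace_on theta (cochain_space i) = (\<Sum>u\<in>W. trace (tX u ** ThX) * trace (ThY ** tY (matrix_inv u)) *
    ((\<Sum>f\<in>{..<i} \<rightarrow>\<^sub>E UNIV. \<Sum>p | p permutes {..<i}.
      of_int (sign p) * (\<Prod>j<i. cmat (wtheta w0 u) $ f j $ f (p j))) / (of_nat (card W) * fact i)))"
proof -
  let ?c = "1 / (of_nat (card W) * fact i) :: complex"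
  let ?A = "\<lambda>u. cmat (wtheta w0 u)"
  let ?P = "\<lambda>u. ThY ** tY (matrix_inv u)" and ?Q = "\<lambda>u. tX u ** ThX"
  let ?m = "\<lambda>u f. \<Sum>p | p permutes {..<i}. of_int (sign p) * (\<Prod>j<i. ?A u $ f j $ f (p j))"
  have entry: "form_coeff (f, a, b) (theta (average i (elementary_form i (f, a, b))))
      = (\<Sum>u\<in>W. ?c * ?m u f * (?P u $ a $ a * ?Q u $ b $ b))" for f :: "nat \<Rightarrow> 'n" and a :: 'y and b :: 'x
  proof -
    \<comment> \<open>The arguments receive u from the average and -w0 from theta; the product is
      the matrix of u theta on V.\<close>
    have ax: "cmv u (thetaV w0 (axis m 1)) $ r = ?A u $ r $ m" for u m r
      by (simp add: thetaV_cmv cmv_mult[symmetric] cmv_axis wtheta_def)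
    have PQ: "ThY ** (tY (matrix_inv u) ** M ** tX u) ** ThX = ?P u ** M ** ?Q u" for u M
      by (simp add: matrix_mul_assoc)
    have "theta (average i (elementary_form i (f, a, b))) (\<lambda>j. axis (f j) 1)
        = cscale ?c (\<Sum>u\<in>W. \<Sum>p | p permutes {..<i}. cscale (of_int (sign p))
            (cscale (\<Prod>j<i. ?A u $ f j $ f (p j)) (?P u ** matrix_unit a b ** ?Q u)))"
      unfolding theta_star_def average_def elementary_form_def prod.case ax
        matrix_mult_sum_left matrix_mult_sum_right cscale_matrix_mult_left cscale_matrix_mult_right PQ ..
    then show ?thesis
      by (simp add: form_coeff_def matrix_unit_sandwich sum_distrib_left sum_distrib_right mult.assoc)
  qed
  have "cochain.trace_on theta (cochain_space i)
      = (\<Sum>q\<in>form_indices i. form_coeff q (theta (average i (elementary_form i q))))"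
    by (rule cochain.trace_on_frame[OF subspace_cochains frame_cochains linear_theta])
       (use theta_cochain in blast)
  also have "\<dots> = (\<Sum>f\<in>{..<i} \<rightarrow>\<^sub>E UNIV. \<Sum>a\<in>UNIV. \<Sum>b\<in>UNIV. \<Sum>u\<in>W.
      ?c * ?m u f * (?P u $ a $ a * ?Q u $ b $ b))"
    unfolding sum_form_indices entry ..
  also have "\<dots> = (\<Sum>f\<in>{..<i} \<rightarrow>\<^sub>E UNIV. \<Sum>u\<in>W. ?c * ?m u f * (trace (?P u) * trace (?Q u)))"
  proof (rule sum.cong[OF refl])
    fix f :: "nat \<Rightarrow> 'n"
    have prod: "(\<Sum>a\<in>UNIV. \<Sum>b\<in>UNIV. z * (g a * h b)) = z * ((\<Sum>a\<in>UNIV. g a) * (\<Sum>b\<in>UNIV. h b))"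
      for z and g :: "'y \<Rightarrow> complex" and h :: "'x \<Rightarrow> complex"
      by (simp only: sum_distrib_left[symmetric] sum_distrib_right[symmetric])
    have "(\<Sum>a\<in>UNIV. \<Sum>b\<in>UNIV. \<Sum>u\<in>W. ?c * ?m u f * (?P u $ a $ a * ?Q u $ b $ b))
        = (\<Sum>a\<in>UNIV. \<Sum>u\<in>W. \<Sum>b\<in>UNIV. ?c * ?m u f * (?P u $ a $ a * ?Q u $ b $ b))"
      by (rule sum.cong[OF refl], rule sum.swap)
    also have "\<dots> = (\<Sum>u\<in>W. \<Sum>a\<in>UNIV. \<Sum>b\<in>UNIV. ?c * ?m u f * (?P u $ a $ a * ?Q u $ b $ b))"
      by (rule sum.swap)
    also have "\<dots> = (\<Sum>u\<in>W. ?c * ?m u f * (trace (?P u) * trace (?Q u)))"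
      unfolding trace_def by (rule sum.cong[OF refl prod])
    finally show "(\<Sum>a\<in>UNIV. \<Sum>b\<in>UNIV. \<Sum>u\<in>W. ?c * ?m u f * (?P u $ a $ a * ?Q u $ b $ b))
        = (\<Sum>u\<in>W. ?c * ?m u f * (trace (?P u) * trace (?Q u)))" .
  qed
  also have "\<dots> = (\<Sum>u\<in>W. trace (?Q u) * trace (?P u) * ((\<Sum>f\<in>{..<i} \<rightarrow>\<^sub>E UNIV. ?m u f) / (of_nat (card W) * fact i)))"
  proof (subst sum.swap, rule sum.cong[OF refl])
    have "(\<Sum>f\<in>F. 1 / z * g f * (x * y)) = y * x * ((\<Sum>f\<in>F. g f) / z)"
      for F :: "(nat \<Rightarrow> 'n) set" and g and x y z :: complex
      by (simp add: sum_distrib_left sum_divide_distrib ac_simps)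
    then show "(\<Sum>f\<in>{..<i} \<rightarrow>\<^sub>E UNIV. ?c * ?m u f * (trace (?P u) * trace (?Q u)))
        = trace (?Q u) * trace (?P u) * ((\<Sum>f\<in>{..<i} \<rightarrow>\<^sub>E UNIV. ?m u f) / (of_nat (card W) * fact i))" for u .
  qed
  finally show ?thesis .
qed

text \<open>As theta is an involution, the left side is the trace of the inverse of u theta. The
  finite set is the image in End(Y) of the semidirect product of W with theta, closed because theta
  conjugates \<open>tY\<close> within its image.\<close>

lemma trace_tY_inverse:
  assumes u: "u \<in> W"
  shows "trace (ThY ** tY (matrix_inv u)) = cnj (trace (tY u ** ThY))"
proof (rule trace_inverse_eq_cnj)
  have "tY u ** ThY ** (ThY ** tY (matrix_inv u)) = tY u ** (ThY ** ThY) ** tY (matrix_inv u)"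
    by (simp only: matrix_mul_assoc)
  then show "tY u ** ThY ** (ThY ** tY (matrix_inv u)) = mat 1"
    by (simp add: Y(7) tY_inv[OF u])
  let ?S = "tY ` W \<union> (\<lambda>w. tY w ** ThY) ` W"
  show "finite ?S" using finite_weyl by simp
  show "mat 1 \<in> ?S" using Y(1) weyl_one[of R cor] by (metis UnI1 image_eqI)
  fix g assume "g \<in> ?S"
  then consider w where "w \<in> W" "g = tY w" | w where "w \<in> W" "g = tY w ** ThY" by blast
  then show "g ** (tY u ** ThY) \<in> ?S"
  proof cases
    case 1
    then have "g ** (tY u ** ThY) = tY (w ** u) ** ThY" "w ** u \<in> W"
      using Y(2)[OF 1(1) u] weyl_mult[OF 1(1) u] by (simp_all add: matrix_mul_assoc)
    then show ?thesis by blast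
  next
    case 2
    let ?u = "w0 ** u ** matrix_inv w0"
    have u': "?u \<in> W" using u longest_weyl by (intro weyl_mult weyl_matrix_inv)
    have "g ** (tY u ** ThY) = tY w ** (ThY ** tY u ** ThY)"
      by (simp add: 2 matrix_mul_assoc)
    also have "\<dots> = tY (w ** ?u)" using Y(8)[OF u] Y(2)[OF 2(1) u'] by simp
    finally show ?thesis using weyl_mult[OF 2(1) u'] by blast
  qed
qed

theorem EP_theta_eq_pairing:
  "EP_theta R cor D tX tY vX vY ThX ThY = twisted_elliptic_pairing R cor D tX tY ThX ThY"
proof -
  let ?n = "CARD('n)"
  let ?M = "\<lambda>i u. \<Sum>f\<in>{..<i} \<rightarrow>\<^sub>E UNIV. \<Sum>p | p permutes {..<i}.
      of_int (sign p) * (\<Prod>j<i. cmat (wtheta w0 u) $ f j $ f (p j))"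
  let ?t = "\<lambda>u. trace (tX u ** ThX) * cnj (trace (tY u ** ThY))"
  \<comment> \<open>Exterior powers beyond the dimension of V vanish, so the sum defining
    \<open>EP_theta\<close> sees the whole complex.\<close>
  have top: "cochain_space (Suc ?n) = {0}"
  proof
    show "cochain_space (Suc ?n) \<subseteq> {0}"
      using altmap_vanish[of "Suc ?n"] cochains_iff by auto
    show "{0} \<subseteq> cochain_space (Suc ?n)"
      using cochain.subspace_0[OF subspace_cochains] by simp
  qed
  have "EP_theta R cor D tX tY vX vY ThX ThY
      = (\<Sum>i\<le>?n. (-1) ^ i * cochain.trace_on theta (cochain_space i))"
    unfolding EP_theta_def ext_theta_trace_def cocycles_def coboundaries_def
    by (rule cochain.euler_trace[where C = cochain_space and d = "dstar vX vY"])
       (use dstar_cochain theta_cochain in \<open>auto simp: fin_dim_cochains top linear_dstar dstar_dstar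
          linear_theta theta_dstar\<close>)
  also have "\<dots> = (\<Sum>i\<le>?n. \<Sum>u\<in>W. ?t u / of_nat (card W) * ((-1) ^ i / fact i * ?M i u))"
  proof (rule sum.cong[OF refl])
    fix i
    have "(-1) ^ i * cochain.trace_on theta (cochain_space i)
        = (\<Sum>u\<in>W. (-1) ^ i * (?t u * (?M i u / (of_nat (card W) * fact i))))"
      unfolding trace_theta_cochains sum_distrib_left[of "(-1) ^ i"]
      by (intro sum.cong refl) (simp only: trace_tY_inverse)
    then show "(-1) ^ i * cochain.trace_on theta (cochain_space i)
        = (\<Sum>u\<in>W. ?t u / of_nat (card W) * ((-1) ^ i / fact i * ?M i u))"
      by (simp add: divide_inverse ac_simps)
  qed
  \<comment> \<open>For fixed u the degree enters only through the tuple sums, and their signed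
    total is the determinant of 1 - u theta.\<close>
  also have "\<dots> = (\<Sum>u\<in>W. ?t u / of_nat (card W) * (\<Sum>i\<le>?n. (-1) ^ i / fact i * ?M i u))"
    by (subst sum.swap) (simp only: sum_distrib_left[symmetric])
  also have "\<dots> = (\<Sum>u\<in>W. ?t u / of_nat (card W) * det (mat 1 - cmat (wtheta w0 u)))"
    by (simp only: det_one_minus_tuples)
  also have "\<dots> = twisted_elliptic_pairing R cor D tX tY ThX ThY"
    unfolding twisted_elliptic_pairing_def Let_def sum_distrib_left
    by (intro sum.cong refl) simp
  finally show ?thesis .
qed

end

theorem theorem4p11:
  fixes R D :: "(real^'n) set"
    and cor :: "real^'n \<Rightarrow> real^'n"
    and k :: "real^'n \<Rightarrow> real"
    and tX :: "real^'n^'n \<Rightarrow> complex^'x^'x" and vX :: "complex^'n \<Rightarrow> complex^'x^'x"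
    and ThX :: "complex^'x^'x"
    and tY :: "real^'n^'n \<Rightarrow> complex^'y^'y" and vY :: "complex^'n \<Rightarrow> complex^'y^'y"
    and ThY :: "complex^'y^'y"
  assumes "reduced_cryst_root_system R cor"
    and "simple_system R D"
    and "\<forall>w\<in>weyl R cor. \<forall>a\<in>R. k (w *v a) = k a"
    and "H_theta_module R cor D k tX vX ThX"
    and "H_theta_module R cor D k tY vY ThY"
  shows "EP_theta R cor D tX tY vX vY ThX ThY = twisted_elliptic_pairing R cor D tX tY ThX ThY"
proof -
  interpret twisted_module_pair R D cor k tX vX ThX tY vY ThY
    using assms by unfold_locales
  show ?thesis by (rule EP_theta_eq_pairing)
qed

end
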